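(* Let $E_2(q)=1-24\sum_{n\ge1}\frac{nq^n}{1-q^n}$ and $\mathcal P=E_2(q^7)$, and let $x,y,z$ be as in the context. Then $$q\frac{dx}{dq}=\frac{x}{12}\left(5y^2+5z^2-7x^2+20yz+52xy+7\mathcal P\right),\quad q\frac{dy}{dq}=\frac{y}{12}\left(5z^2+5x^2-7y^2+20xz+52yz+7\mathcal P\right),$$ $$q\frac{dz}{dq}=\frac{z}{12}\left(5x^2+5y^2-7z^2+20xy+52xz+7\mathcal P\right),$$ $$q\frac{d\mathcal P}{dq}=\frac{7}{12}\left(\mathcal P^2-x^4-4x^3y-12xy^3-y^4-12x^3z-4y^3z-4xz^3-12yz^3-z^4\right).$$
   Context: $|q|<1$, $(a;q)_\infty=\prod_{j\ge0}(1-aq^j)$, $(a_1,\dots,a_r;q)_\infty=\prod_i(a_i;q)_\infty$, and $x=q\frac{(q^2,q^5,q^7,q^7;q^7)_\infty}{(q^3,q^4;q^7)_\infty^2}$, $y=-q\frac{(q,q^6,q^7,q^7;q^7)_\infty}{(q^2,q^5;q^7)_\infty^2}$, $z=\frac{(q^3,q^4,q^7,q^7;q^7)_\infty}{(q,q^6;q^7)_\infty^2}$. *)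

theory Defs
  imports "HOL-Analysis.Analysis"
begin

definition qpoch :: "complex \<Rightarrow> complex \<Rightarrow> complex" where
  "qpoch a q = (\<Prod>j. 1 - a * q ^ j)"

definition qpochs :: "complex list \<Rightarrow> complex \<Rightarrow> complex" where
  "qpochs as q = (\<Prod>a\<leftarrow>as. qpoch a q)"

definition x7 :: "complex \<Rightarrow> complex" where
  "x7 q = q * (qpochs [q ^ 2, q ^ 5, q ^ 7, q ^ 7] (q ^ 7) / (qpochs [q ^ 3, q ^ 4] (q ^ 7)) ^ 2)"

definition y7 :: "complex \<Rightarrow> complex" where
  "y7 q = - q * (qpochs [q, q ^ 6, q ^ 7, q ^ 7] (q ^ 7) / (qpochs [q ^ 2, q ^ 5] (q ^ 7)) ^ 2)"

definition z7 :: "complex \<Rightarrow> complex" where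
  "z7 q = qpochs [q ^ 3, q ^ 4, q ^ 7, q ^ 7] (q ^ 7) / (qpochs [q, q ^ 6] (q ^ 7)) ^ 2"

(* The sum over n >= 1 is indexed by n = Suc k. *)
definition E2 :: "complex \<Rightarrow> complex" where
  "E2 q = 1 - 24 * (\<Sum>k. of_nat (Suc k) * q ^ Suc k / (1 - q ^ Suc k))"

definition P7 :: "complex \<Rightarrow> complex" where
  "P7 q = E2 (q ^ 7)"

end

theory Submission
  imports Defs "HOL-Complex_Analysis.Complex_Analysis"
begin

text \<open>
  Put \<open>p = q\<^sup>7\<close> and let \<open>\<zeta>(u) = 1/2 + \<Sum>\<^bsub>n \<noteq> 0\<^esub> u\<^sup>n / (1 - p\<^sup>n)\<close>, essentially the Weierstrass zeta function
  in the multiplicative coordinate \<open>u\<close>. Partial fractions applied to the coefficients of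
  \<open>\<zeta>(a) \<zeta>(b)\<close> and \<open>\<zeta>(u)\<^sup>2\<close> give the addition formula
  \<open>(\<zeta>(a) + \<zeta>(b) - \<zeta>(ab))\<^sup>2 = \<wp>(a) + \<wp>(b) + \<wp>(ab) + P/4\<close>, where \<open>\<wp> = u \<zeta>'(u)\<close>, and the heat equation that turns
  \<open>p d/dp\<close> into \<open>u d/du\<close>. At the 7-torsion points \<open>u = q, q\<^sup>2, q\<^sup>3\<close> the addition formula and its \<open>u\<close>-derivatives
  express \<open>\<wp>, \<wp>', \<wp>''\<close> through the three values of \<open>\<zeta>\<close>, so these values, shifted by
  \<open>-a/7\<close>, satisfy a closed system together with \<open>P\<close>. Three linear combinations \<open>X, Y, Z\<close> of them have the same
  logarithmic derivatives and the same leading terms at \<open>q = 0\<close> as the theta quotients \<open>x, y, z\<close>; hence they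
  are equal, and the system is the claimed one.
\<close>

subsection \<open>Lambert series\<close>

text \<open>Radius of convergence at least 1 for the power series with coefficients
  \<open>w\<close>. The class contains all \<open>n ^ k\<close> and \<open>1 / n\<close>, and it is
  closed under the multiplication by \<open>n\<close> that \<open>q d/dq\<close> causes.\<close>

definition subexp :: "(nat \<Rightarrow> complex) \<Rightarrow> bool" where
  "subexp w \<longleftrightarrow> (\<forall>r. 0 \<le> r \<longrightarrow> r < 1 \<longrightarrow> summable (\<lambda>n. norm (w n) * r ^ n))"

lemma subexp_times_n:
  assumes "subexp w"
  shows "subexp (\<lambda>n. of_nat n * w n)"
  unfolding subexp_def
proof (intro allI impI)
  fix r :: real assume r: "0 \<le> r" "r < 1"
  have "summable (\<lambda>n. diffs (\<lambda>n. norm (w n)) n * r ^ n)"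
  proof (rule termdiff_converges)
    fix x :: real assume x: "norm x < 1"
    have "summable (\<lambda>n. norm (norm (w n) * x ^ n))"
      using assms x by (simp add: subexp_def abs_mult power_abs)
    then show "summable (\<lambda>n. norm (w n) * x ^ n)" by (rule summable_norm_cancel)
  qed (use r in auto)
  then have "summable (\<lambda>n. diffs (\<lambda>n. norm (w n)) n * r ^ n * r)"
    by (rule summable_mult2)
  then have "summable (\<lambda>n. (of_nat (Suc n) * norm (w (Suc n))) * r ^ Suc n)"
    by (simp add: diffs_def mult_ac)
  then have "summable (\<lambda>n. (of_nat n * norm (w n)) * r ^ n)"
    by (subst (asm) summable_Suc_iff)
  then show "summable (\<lambda>n. norm (of_nat n * w n) * r ^ n)"
    by (simp add: norm_mult)
qed

section \<open>Unconditional sums over products and over the integers\<close>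

lemma has_sum_product:
  fixes f :: "'a \<Rightarrow> complex" and g :: "'b \<Rightarrow> complex"
  assumes "(f has_sum x) A" "(g has_sum y) B"
  shows "((\<lambda>(i,j). f i * g j) has_sum (x * y)) (A \<times> B)"
proof (rule has_sum_SigmaI)
  show "((\<lambda>j. (\<lambda>(i,j). f i * g j) (i, j)) has_sum f i * y) B" for i
    using assms(2) by (simp add: has_sum_cmult_right)
  show "((\<lambda>i. f i * y) has_sum x * y) A"
    by (intro has_sum_cmult_left assms)
  have "(\<lambda>i. norm (f i)) summable_on A" "(\<lambda>j. norm (g j)) summable_on B"
    using assms by (simp_all add: has_sum_imp_summable flip: summable_on_iff_abs_summable_on_complex)
  then have "(\<lambda>x. norm ((\<lambda>(i,j). f i * g j) x)) summable_on (A \<times> B)"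
    unfolding Infinite_Sum.abs_summable_on_Sigma_iff
    by (auto simp: norm_mult infsum_cmult_right' summable_on_cmult_left' abs_mult intro!: summable_on_cmult_right summable_on_cmult_left)
  then show "(\<lambda>(i,j). f i * g j) summable_on (A \<times> B)"
    by (simp flip: summable_on_iff_abs_summable_on_complex)
qed

text \<open>Both half-line series contain the index 0; \<open>f 0 = 0\<close> keeps it from being
  counted twice.\<close>

lemma has_sum_int:
  fixes f :: "int \<Rightarrow> complex"
  assumes "summable (\<lambda>n. norm (f (int n)))" "summable (\<lambda>n. norm (f (- int n)))" "f 0 = 0"
  shows "(f has_sum ((\<Sum>n. f (int n)) + (\<Sum>n. f (- int n)))) UNIV"
proof -
  have 1: "((\<lambda>n. f (int n)) has_sum (\<Sum>n. f (int n))) UNIV"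
    using assms(1) by (intro norm_summable_imp_has_sum) (auto dest: summable_norm_cancel)
  have 2: "((\<lambda>n. f (- int n)) has_sum (\<Sum>n. f (- int n))) UNIV"
    using assms(2) by (intro norm_summable_imp_has_sum) (auto dest: summable_norm_cancel)
  have "((f \<circ> int) has_sum (\<Sum>n. f (int n))) UNIV" using 1 by (simp add: o_def)
  then have a: "(f has_sum (\<Sum>n. f (int n))) (range int)"
    by (subst has_sum_reindex) (auto simp: inj_on_def)
  have "((\<lambda>n. f (- int n)) has_sum (\<Sum>n. f (- int n))) {0<..}"
    using 2 by (rule has_sum_cong_neutral[THEN iffD1, rotated -1]) (use assms(3) in auto)
  then have "((f \<circ> (\<lambda>n. - int n)) has_sum (\<Sum>n. f (- int n))) {0<..}" by (simp add: o_def)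
  then have b: "(f has_sum (\<Sum>n. f (- int n))) ((\<lambda>n. - int n) ` {0<..})"
    by (subst has_sum_reindex) (auto simp: inj_on_def)
  have "range int \<union> (\<lambda>n. - int n) ` {0<..} = UNIV"
  proof -
    have "x \<in> range int \<union> (\<lambda>n. - int n) ` {0<..}" for x
      by (cases x rule: int_cases) (auto intro: rangeI image_eqI[where x="Suc _"])
    then show ?thesis by blast
  qed
  moreover have "range int \<inter> (\<lambda>n. - int n) ` {0<..} = {}" by auto
  ultimately show ?thesis using has_sum_Un_disjoint[OF a b] by simp
qed

text \<open>
  The summand for \<open>n = 0\<close> is a division by 0 and vanishes, so both series start at \<open>n = 1\<close>.
\<close>

definition lam :: "(nat \<Rightarrow> complex) \<Rightarrow> complex \<Rightarrow> complex \<Rightarrow> complex" where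
  "lam w p u = (\<Sum>n. w n * u ^ n / (1 - p ^ n))"

definition lam2 :: "(nat \<Rightarrow> complex) \<Rightarrow> complex \<Rightarrow> complex \<Rightarrow> complex" where
  "lam2 w p u = (\<Sum>n. w n * (p * u) ^ n / (1 - p ^ n)\<^sup>2)"

lemma norm_one_minus_power_ge:
  fixes p :: complex
  assumes "norm p \<le> r" "r < 1" "n > 0"
  shows "norm (1 - p ^ n) \<ge> 1 - r"
proof -
  have "norm (p ^ n) \<le> r"
  proof -
    have "norm p ^ n \<le> norm p ^ 1" using assms by (intro power_decreasing) auto
    then show ?thesis using assms by (simp add: norm_power)
  qed
  moreover have "norm (1 - p ^ n) \<ge> norm (1::complex) - norm (p ^ n)" by (rule norm_triangle_ineq2)
  ultimately show ?thesis by simp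
qed

text \<open>The bound is uniform in \<open>p\<close> and \<open>u\<close>, so it gives summability
  and also the majorant for termwise differentiation in
  \<open>has_field_derivative_lam\<close>.\<close>

lemma lam_term_bound:
  fixes p u :: complex
  assumes "norm p \<le> r" "norm u \<le> r" "r < 1"
  shows "norm (w n * u ^ n / (1 - p ^ n)) \<le> norm (w n) * r ^ n * inverse (1 - r)"
proof (cases "n = 0")
  case True
  then show ?thesis using assms norm_ge_zero[of p] by simp
next
  case False
  have "inverse (norm (1 - p ^ n)) \<le> inverse (1 - r)"
    using norm_one_minus_power_ge[of p r n] assms False by (intro le_imp_inverse_le) auto
  moreover have "norm u ^ n \<le> r ^ n" using assms by (intro power_mono) auto
  ultimately have "norm (w n) * norm u ^ n * inverse (norm (1 - p ^ n)) \<le> norm (w n) * r ^ n * inverse (1 - r)"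
    using assms order_trans[OF norm_ge_zero assms(1)] by (intro mult_mono) auto
  then show ?thesis by (simp add: norm_mult norm_divide norm_power divide_inverse norm_inverse)
qed

lemma lam2_term_bound:
  fixes p u :: complex
  assumes "norm p \<le> r" "norm (p * u) \<le> r" "r < 1"
  shows "norm (w n * (p * u) ^ n / (1 - p ^ n)\<^sup>2) \<le> norm (w n) * r ^ n * inverse ((1 - r)\<^sup>2)"
proof (cases "n = 0")
  case True
  then show ?thesis using assms norm_ge_zero[of p] by simp
next
  case False
  have "inverse ((norm (1 - p ^ n))\<^sup>2) \<le> inverse ((1 - r)\<^sup>2)"
    using norm_one_minus_power_ge[of p r n] assms False by (intro le_imp_inverse_le power_mono) auto
  moreover have "norm (p * u) ^ n \<le> r ^ n" using assms by (intro power_mono) auto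
  ultimately have "norm (w n) * norm (p * u) ^ n * inverse ((norm (1 - p ^ n))\<^sup>2) \<le> norm (w n) * r ^ n * inverse ((1 - r)\<^sup>2)"
    using assms order_trans[OF norm_ge_zero assms(1)] by (intro mult_mono) auto
  then show ?thesis by (simp add: norm_mult norm_divide norm_power divide_inverse norm_inverse)
qed

lemma summable_lam:
  assumes "subexp w" "norm p < 1" "norm u < 1"
  shows "summable (\<lambda>n. norm (w n * u ^ n / (1 - p ^ n)))"
proof -
  define r where "r = max (norm p) (norm u)"
  have r: "norm p \<le> r" "norm u \<le> r" "r < 1" "0 \<le> r" using assms by (auto simp: r_def le_max_iff_disj)
  have "summable (\<lambda>n. norm (w n) * r ^ n * inverse (1 - r))"
    using assms r by (intro summable_mult2) (auto simp: subexp_def)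
  then show ?thesis
    by (rule summable_comparison_test'[where N=0]) (use lam_term_bound[OF r(1-3)] in auto)
qed

lemma summable_lam2:
  assumes "subexp w" "norm p < 1" "norm (p * u) < 1"
  shows "summable (\<lambda>n. norm (w n * (p * u) ^ n / (1 - p ^ n)\<^sup>2))"
proof -
  define r where "r = max (norm p) (norm (p * u))"
  have r: "norm p \<le> r" "norm (p * u) \<le> r" "r < 1" "0 \<le> r" using assms by (auto simp: r_def le_max_iff_disj)
  have "summable (\<lambda>n. norm (w n) * r ^ n * inverse ((1 - r)\<^sup>2))"
    using assms r by (intro summable_mult2) (auto simp: subexp_def)
  then show ?thesis
    by (rule summable_comparison_test'[where N=0]) (use lam2_term_bound[OF r(1-3)] in auto)
qed

subsection \<open>Bilateral sums\<close>

definition cf :: "complex \<Rightarrow> int \<Rightarrow> complex" where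
  "cf p n = 1 / (1 - p powi n)"

text \<open>For \<open>n \<noteq> 0\<close> this is \<open>p ^ n / (1 - p ^ n) ^ 2\<close>. Written
  through \<open>cf\<close>, its symmetry in \<open>n\<close> follows from
  \<open>cf_uminus\<close>.\<close>

definition hf :: "complex \<Rightarrow> int \<Rightarrow> complex" where
  "hf p n = (cf p n)\<^sup>2 - cf p n"

lemma cf_0 [simp]: "cf p 0 = 0" and hf_0 [simp]: "hf p 0 = 0"
  by (simp_all add: cf_def hf_def)

lemma powi_neq_1:
  fixes p :: complex
  assumes "p \<noteq> 0" "norm p < 1" "n \<noteq> 0"
  shows "p powi n \<noteq> 1"
proof -
  have *: "p ^ m \<noteq> 1" if "m > 0" for m
  proof
    assume "p ^ m = 1"
    then have "norm p ^ m = 1" by (metis norm_one norm_power)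
    moreover have "norm p ^ m < 1" using that assms by (simp add: power_less_one_iff)
    ultimately show False by simp
  qed
  show ?thesis
    using *[of "nat n"] *[of "nat (-n)"] assms
    by (auto simp: power_int_def power_inverse split: if_splits)
qed

lemma cf_uminus:
  assumes "p \<noteq> 0" "norm p < 1" "n \<noteq> 0"
  shows "cf p (- n) = 1 - cf p n"
  using powi_neq_1[OF assms] assms by (simp add: cf_def power_int_minus field_simps)

lemma hf_uminus:
  assumes "p \<noteq> 0" "norm p < 1"
  shows "hf p (- n) = hf p n"
  by (cases "n = 0") (simp_all add: hf_def cf_uminus[OF assms] power2_eq_square algebra_simps)

text \<open>Partial fractions: with x = p^m and y = p^n, 1/(1-x) + 1/(1-y) - 1 = (1-xy) /
  ((1-x)(1-y)), and \<open>cf p (- n)\<close> is 1 - 1/(1-y). Written as a difference, the right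
  side telescopes when \<open>m + n\<close> is held fixed.\<close>

lemma cf_mult:
  assumes "p \<noteq> 0" "norm p < 1" "m \<noteq> 0" "n \<noteq> 0" "m + n \<noteq> 0"
  shows "cf p m * cf p n = cf p (m + n) * (cf p m - cf p (- n))"
  using powi_neq_1[OF assms(1,2,3)] powi_neq_1[OF assms(1,2,4)] powi_neq_1[OF assms(1,2,5)] assms
  by (simp add: cf_uminus[OF assms(1,2,4)]) (simp add: cf_def power_int_add divide_simps, simp add: algebra_simps)

text \<open>
  The convention \<open>cf p 0 = 0\<close>, a consequence of \<open>1 / 0 = 0\<close>, is what allows this identity to hold for all \<open>i\<close> and \<open>j\<close>.
\<close>

lemma cf_three_term:
  assumes "p \<noteq> 0" "norm p < 1"
  shows "cf p j * cf p (i - j) + cf p i * cf p (j - i) =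
    cf p i * cf p j - (if i = j then (cf p i)\<^sup>2 else 0)
      - (if i = 0 then hf p j else 0) - (if j = 0 then hf p i else 0)"
proof -
  consider "i = j" | "i \<noteq> j" "i = 0" | "i \<noteq> j" "j = 0" | "i \<noteq> j" "i \<noteq> 0" "j \<noteq> 0" by blast
  then show ?thesis
  proof cases
    case 4
    have "cf p j * cf p (i - j) = cf p i * (cf p j - cf p (j - i))"
      using cf_mult[OF assms, of j "i - j"] 4 by simp
    then show ?thesis using 4 by (simp add: algebra_simps)
  qed (auto simp: cf_uminus[OF assms] hf_def power2_eq_square algebra_simps)
qed

text \<open>
  With the sum over negative \<open>n\<close> rewritten through \<open>p / u\<close>, these are \<open>\<Sum> n\<^sup>k cf(n) u\<^sup>n\<close> and \<open>\<Sum> n\<^sup>k hf(n) u\<^sup>n\<close> over all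
  integers; the second one comes up because \<open>p d/dp\<close> maps \<open>cf(n)\<close> to \<open>n hf(n)\<close>.
\<close>

definition lamS :: "nat \<Rightarrow> complex \<Rightarrow> complex \<Rightarrow> complex" where
  "lamS k p u = lam (\<lambda>n. of_nat n ^ k) p u - (-1) ^ k * lam (\<lambda>n. of_nat n ^ k) p (p / u)"

definition lamH :: "nat \<Rightarrow> complex \<Rightarrow> complex \<Rightarrow> complex" where
  "lamH k p u = lam2 (\<lambda>n. of_nat n ^ k) p u +
     (-1) ^ k * (lam2 (\<lambda>n. of_nat n ^ k) p (p / u) + lam (\<lambda>n. of_nat n ^ k) p (p / u))"

lemma subexp_one: "subexp (\<lambda>n. 1)"
  by (simp add: subexp_def)

lemma subexp_power: "subexp (\<lambda>n. of_nat n ^ k)"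
proof (induction k)
  case (Suc k)
  then show ?case using subexp_times_n[OF Suc] by simp
qed (simp add: subexp_one)

lemma subexp_inverse: "subexp (\<lambda>n. 1 / of_nat n)"
  unfolding subexp_def
proof (intro allI impI)
  fix r :: real assume r: "0 \<le> r" "r < 1"
  then have "summable (\<lambda>n. r ^ n)" by simp
  then show "summable (\<lambda>n. norm (1 / of_nat n :: complex) * r ^ n)"
  proof (rule summable_comparison_test'[where N=0])
    fix n
    have "norm (1 / of_nat n :: complex) \<le> 1" by (cases n) (simp_all add: norm_divide del: of_nat_Suc)
    then have "norm (1 / of_nat n :: complex) * r ^ n \<le> 1 * r ^ n"
      using r by (intro mult_right_mono) auto
    then show "norm (norm (1 / of_nat n :: complex) * r ^ n) \<le> r ^ n" using r by simp
  qed
qed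

text \<open>For n > 0 the term at -n is -(p/u)^n / (1 - p^n) up to the weight, so the two halves
  converge together exactly in the annulus between \<open>norm p\<close> and 1.\<close>

lemma has_sum_lamS:
  assumes p: "p \<noteq> 0" "norm p < norm u" "norm u < 1"
  shows "((\<lambda>n. of_int n ^ k * cf p n * u powi n) has_sum lamS k p u) UNIV"
proof -
  let ?f = "\<lambda>n. of_int n ^ k * cf p n * u powi n" and ?w = "\<lambda>n. of_nat n ^ k :: complex"
  have u: "u \<noteq> 0" "norm p < 1" "norm (p / u) < 1" using p by (auto simp: norm_divide divide_simps)
  have 1: "?f (int n) = ?w n * u ^ n / (1 - p ^ n)" for n
    by (simp add: cf_def)
  have 2: "?f (- int n) = - ((-1) ^ k * (?w n * (p / u) ^ n / (1 - p ^ n)))" for n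
  proof (cases "n = 0")
    case False
    then have "p ^ n \<noteq> 1" using powi_neq_1[of p "int n"] u p by simp
    then show ?thesis using p u
      by (simp add: cf_def power_int_minus power_minus[of "of_nat n"] divide_simps) (simp add: algebra_simps)
  qed simp
  have "(?f has_sum ((\<Sum>n. ?f (int n)) + (\<Sum>n. ?f (- int n)))) UNIV"
    using summable_lam[OF subexp_power[of k] u(2) p(3)] summable_lam[OF subexp_power[of k] u(2,3)]
    by (intro has_sum_int) (simp_all only: 1 2 norm_mult norm_minus_cancel norm_power norm_one mult_1 power_one cf_0 mult_zero_right mult_zero_left)
  also have "(\<Sum>n. ?f (- int n)) = - ((-1) ^ k * (\<Sum>n. ?w n * (p / u) ^ n / (1 - p ^ n)))"
    using summable_norm_cancel[OF summable_lam[OF subexp_power[of k] u(2,3)]]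
    unfolding 2 by (simp only: suminf_minus suminf_mult summable_mult)
  finally show ?thesis unfolding 1 lamS_def lam_def by simp
qed

lemma has_sum_lamH:
  assumes p: "p \<noteq> 0" "norm p < norm u" "norm u < 1"
  shows "((\<lambda>n. of_int n ^ k * hf p n * u powi n) has_sum lamH k p u) UNIV"
proof -
  let ?f = "\<lambda>n. of_int n ^ k * hf p n * u powi n" and ?w = "\<lambda>n. of_nat n ^ k :: complex"
  have u: "u \<noteq> 0" "norm p < 1" "norm (p / u) < 1" using p by (auto simp: norm_divide divide_simps)
  have pu: "norm (p * u) < 1" "norm (p * (p / u)) < 1"
  proof -
    have "norm p * norm u < 1 * 1" using u p by (intro mult_strict_mono) auto
    moreover have "norm p * norm (p / u) < 1 * 1" using u p by (intro mult_strict_mono) auto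
    ultimately show "norm (p * u) < 1" "norm (p * (p / u)) < 1" by (simp_all only: norm_mult)
  qed
  have p1: "p ^ n \<noteq> 1" if "n \<noteq> 0" for n using powi_neq_1[of p "int n"] u p that by simp
  have 1: "?f (int n) = ?w n * (p * u) ^ n / (1 - p ^ n)\<^sup>2" for n
  proof (cases "n = 0")
    case False
    then show ?thesis using p1[OF False] p u
      by (simp add: hf_def cf_def divide_simps power_mult_distrib) (simp add: power2_eq_square algebra_simps)
  qed simp
  \<comment> \<open>The term is (p/u)^n / (1 - p^n)^2 up to the weight; writing the numerator 1 as
    p^n + (1 - p^n) splits it into a \<open>lam2\<close> and a \<open>lam\<close> term, the shape
    that \<open>q d/dq\<close> produces later.\<close>
  have 2: "?f (- int n) = (-1) ^ k * (?w n * (p * (p / u)) ^ n / (1 - p ^ n)\<^sup>2 + ?w n * (p / u) ^ n / (1 - p ^ n))" for n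
  proof (cases "n = 0")
    case False
    have "hf p (- int n) = hf p (int n)" using hf_uminus[OF p(1) u(2)] .
    then show ?thesis using p1[OF False] p u
      by (simp add: hf_def cf_def divide_simps power_mult_distrib power_int_minus power_minus[of "of_nat n"])
        (simp add: power2_eq_square algebra_simps)
  qed simp
  note s = summable_lam2[OF subexp_power[of k] u(2) pu(1)] summable_lam2[OF subexp_power[of k] u(2) pu(2)]
    summable_lam[OF subexp_power[of k] u(2,3)]
  have "(?f has_sum ((\<Sum>n. ?f (int n)) + (\<Sum>n. ?f (- int n)))) UNIV"
  proof (rule has_sum_int)
    show "summable (\<lambda>n. norm (?f (int n)))" unfolding 1 by (rule s)
    show "summable (\<lambda>n. norm (?f (- int n)))" unfolding 2
      by (rule summable_comparison_test'[OF summable_add[OF s(2,3)], of 0])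
        (simp only: norm_mult norm_power norm_minus_cancel norm_one power_one mult_1 real_norm_def abs_norm_cancel norm_triangle_ineq)
  qed simp
  also have "(\<Sum>n. ?f (- int n)) = (-1) ^ k * ((\<Sum>n. ?w n * (p * (p / u)) ^ n / (1 - p ^ n)\<^sup>2) + (\<Sum>n. ?w n * (p / u) ^ n / (1 - p ^ n)))"
    unfolding 2 using s(2,3)[THEN summable_norm_cancel] by (simp only: suminf_add suminf_mult summable_add)
  finally show ?thesis unfolding 1 lamH_def lam_def lam2_def by simp
qed

section \<open>The three-term relation summed over pairs of integers\<close>

lemma has_sum_diff:
  fixes f g :: "'a \<Rightarrow> complex"
  assumes "(f has_sum a) A" "(g has_sum b) A"
  shows "((\<lambda>x. f x - g x) has_sum (a - b)) A"
  using has_sum_add[OF assms(1) has_sum_cmult_right[OF assms(2), of "-1"]] by simp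

text \<open>Turns the one-index correction terms, supported on the diagonal and on the two axes,
  into double sums.\<close>

lemma has_sum_on_graph:
  fixes f :: "'a \<Rightarrow> complex" and h :: "'a \<Rightarrow> 'b"
  assumes "(f has_sum d) UNIV" "\<And>x. g (h x) = f x" "\<And>y. y \<notin> range h \<Longrightarrow> g y = 0" "inj h"
  shows "(g has_sum d) UNIV"
proof -
  have "((g \<circ> h) has_sum d) UNIV"
    using assms by (simp add: o_def)
  then have "(g has_sum d) (range h)"
    using assms(4) by (simp add: has_sum_reindex)
  then show ?thesis
    by (rule has_sum_cong_neutral[THEN iffD1, rotated -1]) (use assms in auto)
qed

text \<open>
  The weights \<open>1\<close>, \<open>i\<close> and \<open>i j\<close> give the addition formula and its derivatives with respect to \<open>a\<close> and to
  both \<open>a\<close> and \<open>b\<close>, without any termwise differentiation.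
\<close>

lemma three_term_weighted:
  fixes W :: "int \<Rightarrow> int \<Rightarrow> complex"
  assumes p: "p \<noteq> 0" "norm p < 1" and ab: "a \<noteq> 0" "b \<noteq> 0"
  assumes F1: "((\<lambda>(k,m). W (k + m) k * (cf p k * (a * b) powi k * (cf p m * a powi m))) has_sum s1) (UNIV \<times> UNIV)"
    and F2: "((\<lambda>(k,m). W k (k + m) * (cf p k * (a * b) powi k * (cf p m * b powi m))) has_sum s2) (UNIV \<times> UNIV)"
    and F3: "((\<lambda>(i,j). W i j * (cf p i * a powi i * (cf p j * b powi j))) has_sum s3) (UNIV \<times> UNIV)"
    and D1: "((\<lambda>i. W i i * (hf p i + cf p i) * (a * b) powi i) has_sum d1) UNIV"
    and D2: "((\<lambda>j. W 0 j * hf p j * b powi j) has_sum d2) UNIV"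
    and D3: "((\<lambda>i. W i 0 * hf p i * a powi i) has_sum d3) UNIV"
  shows "s1 + s2 = s3 - d1 - d2 - d3"
proof -
  \<comment> \<open>Put i = k + m and j = k: then (ab)^k a^m = a^i b^j, so all three products are
    sums over the same monomials. The second product uses i = k and j = k + m.\<close>
  have F1': "((\<lambda>(i,j). W i j * (cf p j * cf p (i - j) * (a powi i * b powi j))) has_sum s1) (UNIV \<times> UNIV)"
    using F1
  proof (rule has_sum_reindex_bij_witness[THEN iffD1, rotated -1])
    show "(case case x of (k, m) \<Rightarrow> (k + m, k) of (i, j) \<Rightarrow> W i j * (cf p j * cf p (i - j) * (a powi i * b powi j))) =
      (case x of (k, m) \<Rightarrow> W (k + m) k * (cf p k * (a * b) powi k * (cf p m * a powi m)))" for x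
      using ab by (cases x) (simp add: power_int_mult_distrib power_int_add)
    show "(\<lambda>(i, j). (j, i - j)) ((\<lambda>(k, m). (k + m, k)) x) = x" for x :: "int \<times> int" by (cases x) auto
    show "(\<lambda>(k, m). (k + m, k)) ((\<lambda>(i, j). (j, i - j)) x) = x" for x :: "int \<times> int" by (cases x) auto
  qed auto
  have F2': "((\<lambda>(i,j). W i j * (cf p i * cf p (j - i) * (a powi i * b powi j))) has_sum s2) (UNIV \<times> UNIV)"
    using F2
  proof (rule has_sum_reindex_bij_witness[THEN iffD1, rotated -1])
    show "(case case x of (k, m) \<Rightarrow> (k, k + m) of (i, j) \<Rightarrow> W i j * (cf p i * cf p (j - i) * (a powi i * b powi j))) =
      (case x of (k, m) \<Rightarrow> W k (k + m) * (cf p k * (a * b) powi k * (cf p m * b powi m)))" for x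
      using ab by (cases x) (simp add: power_int_mult_distrib power_int_add)
    show "(\<lambda>(i, j). (i, j - i)) ((\<lambda>(k, m). (k, k + m)) x) = x" for x :: "int \<times> int" by (cases x) auto
    show "(\<lambda>(k, m). (k, k + m)) ((\<lambda>(i, j). (i, j - i)) x) = x" for x :: "int \<times> int" by (cases x) auto
  qed auto
  \<comment> \<open>On the diagonal \<open>hf p i + cf p i\<close> is
    \<open>(cf p i)\<^sup>2\<close>, the correction term of \<open>cf_three_term\<close>.\<close>
  have D1': "((\<lambda>(i,j). W i j * ((if i = j then (cf p i)\<^sup>2 else 0) * (a powi i * b powi j))) has_sum d1) UNIV"
    by (rule has_sum_on_graph[OF D1, where h = "\<lambda>i. (i, i)"])
      (auto simp: inj_on_def hf_def power_int_mult_distrib)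
  have D2': "((\<lambda>(i,j). W i j * ((if i = 0 then hf p j else 0) * (a powi i * b powi j))) has_sum d2) UNIV"
    by (rule has_sum_on_graph[OF D2, where h = "\<lambda>j. (0, j)"]) (auto simp: inj_on_def)
  have D3': "((\<lambda>(i,j). W i j * ((if j = 0 then hf p i else 0) * (a powi i * b powi j))) has_sum d3) UNIV"
    by (rule has_sum_on_graph[OF D3, where h = "\<lambda>i. (i, 0)"]) (auto simp: inj_on_def)
  have "((\<lambda>(i,j). W i j * ((cf p j * cf p (i - j) + cf p i * cf p (j - i)) * (a powi i * b powi j)))
     has_sum (s1 + s2)) UNIV"
    using has_sum_add[OF F1' F2'] by (simp add: case_prod_unfold algebra_simps)
  moreover have "((\<lambda>(i,j). W i j * ((cf p j * cf p (i - j) + cf p i * cf p (j - i)) * (a powi i * b powi j)))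
     has_sum (s3 - d1 - d2 - d3)) UNIV"
    unfolding cf_three_term[OF p]
    using has_sum_diff[OF has_sum_diff[OF has_sum_diff[OF F3[simplified] D1'] D2'] D3']
    by (simp add: case_prod_unfold algebra_simps)
  ultimately show ?thesis by (rule has_sum_unique)
qed

section \<open>Convolution of the coefficients \<open>cf\<close> with themselves\<close>

lemma has_sum_shift_difference:
  fixes d :: "int \<Rightarrow> complex"
  assumes "d summable_on UNIV"
  shows "((\<lambda>i. d i - d (i - n)) has_sum 0) UNIV"
proof -
  obtain s where s: "(d has_sum s) UNIV" using assms by (auto simp: summable_on_def)
  have "((\<lambda>i. d (i - n)) has_sum s) UNIV"
    using s by (subst has_sum_reindex_bij_betw[of "\<lambda>i. i - n" UNIV UNIV])
      (auto intro: bij_betwI[where g = "\<lambda>i. i + n"])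
  from has_sum_diff[OF s this] show ?thesis by simp
qed

text \<open>Telescoping: a shift by \<open>n\<close> contributes \<open>n\<close> times the jump
  between the limits of \<open>cf p i\<close> at the two ends, although \<open>cf p\<close> itself
  is not summable.\<close>

lemma has_sum_cf_difference:
  assumes p: "p \<noteq> 0" "norm p < 1"
  shows "((\<lambda>i. cf p i - cf p (i - n)) has_sum of_int n) UNIV"
proof -
  \<comment> \<open>Split off the limits 1 and 0 of \<open>cf p i\<close> as \<open>i\<close> tends to plus and minus infinity; the rest is summable.\<close>
  define d where "d i = cf p i - (if i > 0 then 1 else 0)" for i
  have p1: "p ^ n \<noteq> 1" if "n \<noteq> 0" for n using powi_neq_1[of p "int n"] p that by simp
  note s = summable_lam[OF subexp_one p(2) p(2)]
  have 1: "d (int n) = (if n = 0 then 0 else 1 * p ^ n / (1 - p ^ n))" for n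
    using p1[of n] by (auto simp: d_def cf_def divide_simps)
  have 2: "d (- int n) = - (1 * p ^ n / (1 - p ^ n))" for n
    using p1[of n] p by (auto simp: d_def cf_def divide_simps power_int_minus) (simp add: algebra_simps)
  have "summable (\<lambda>n. norm (d (int n)))" "summable (\<lambda>n. norm (d (- int n)))"
    by (rule summable_comparison_test'[OF s, of 0]; simp add: 1 2)+
  then have "d summable_on UNIV" using has_sum_int[of d] by (auto simp: d_def summable_on_def)
  from has_sum_shift_difference[OF this]
  have a: "((\<lambda>i. d i - d (i - n)) has_sum 0) UNIV" .
  have b: "((\<lambda>i. (if i > 0 then 1 else 0) - (if i - n > 0 then 1 else 0 :: complex)) has_sum of_int n) UNIV"
  proof (cases "n \<ge> 0")
    case True
    show ?thesis
      by (rule has_sum_finite_neutralI[of "{0<..n}"]) (use True in auto)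
  next
    case False
    show ?thesis
      by (rule has_sum_finite_neutralI[of "{n<..0}"]) (use False in \<open>auto simp: sum_negf\<close>)
  qed
  show ?thesis using has_sum_add[OF a b] by (simp add: d_def algebra_simps)
qed

lemma has_sum_hf:
  assumes p: "p \<noteq> 0" "norm p < 1"
  shows "(hf p has_sum 2 * lam2 (\<lambda>_. 1) p 1) UNIV"
proof -
  have p1: "p ^ n \<noteq> 1" if "n \<noteq> 0" for n using powi_neq_1[of p "int n"] p that by simp
  have 1: "hf p (int n) = 1 * (p * 1) ^ n / (1 - p ^ n)\<^sup>2" for n
  proof (cases "n = 0")
    case False
    then show ?thesis using p1[OF False] p
      by (simp add: hf_def cf_def divide_simps) (simp add: power2_eq_square algebra_simps)
  qed simp
  have 2: "hf p (- int n) = 1 * (p * 1) ^ n / (1 - p ^ n)\<^sup>2" for n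
    unfolding hf_uminus[OF p] by (rule 1)
  have "summable (\<lambda>n. norm (1 * (p * 1) ^ n / (1 - p ^ n)\<^sup>2))"
    by (rule summable_lam2) (use p subexp_one in auto)
  then have "(hf p has_sum ((\<Sum>n. hf p (int n)) + (\<Sum>n. hf p (- int n)))) UNIV"
    by (intro has_sum_int) (simp_all only: 1 2 hf_0)
  then show ?thesis unfolding 1 2 lam2_def by (simp del: mult_1)
qed

text \<open>These are the Laurent coefficients of the square of the \<open>cf\<close> series. For
  \<open>n \<noteq> 0\<close> the products telescope by \<open>cf_mult\<close>; for
  \<open>n = 0\<close> they are \<open>- hf p i\<close>.\<close>

lemma has_sum_cf_convolution:
  assumes p: "p \<noteq> 0" "norm p < 1"
  shows "((\<lambda>i. cf p i * cf p (n - i)) has_sum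
    (if n = 0 then - 2 * lam2 (\<lambda>_. 1) p 1 else of_int n * cf p n - cf p n - 2 * hf p n)) UNIV"
proof (cases "n = 0")
  case True
  have "cf p i * cf p (0 - i) = - hf p i" for i
    by (cases "i = 0") (auto simp: cf_uminus[OF p] hf_def power2_eq_square algebra_simps)
  then show ?thesis using True has_sum_cmult_right[OF has_sum_hf[OF p], of "-1"] by simp
next
  case False
  \<comment> \<open>\<open>cf_mult\<close> does not apply at i = 0 and i = n, where the left side is
    0 because \<open>cf p 0 = 0\<close>; the two conditional terms restore this value.\<close>
  have *: "cf p i * cf p (n - i) = cf p n *
      (cf p i - cf p (i - n) + ((if i = 0 then cf p (- n) else 0) + (if i = n then - cf p n else 0)))" for i
  proof -
    consider "i = 0" | "i = n" | "i \<noteq> 0" "i \<noteq> n" by blast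
    then show ?thesis
    proof cases
      case 3
      then show ?thesis using cf_mult[OF p, of i "n - i"] False by simp
    qed (use False in auto)
  qed
  have "((\<lambda>i. (if i = 0 then cf p (- n) else 0) + (if i = n then - cf p n else 0)) has_sum (cf p (- n) - cf p n)) UNIV"
    by (rule has_sum_finite_neutralI[of "{0, n}"]) (use False in auto)
  from has_sum_cmult_right[OF has_sum_add[OF has_sum_cf_difference[OF p, of n] this], of "cf p n"]
  show ?thesis using False unfolding * 
    by (simp add: cf_uminus[OF p] hf_def power2_eq_square algebra_simps)
qed

text \<open>Group the double series along n = i + j and insert the convolution coefficients; the
  weight \<open>n ^ k\<close> plays the role of k applications of \<open>u d/du\<close>. As
  \<open>0 ^ 0 = 1\<close>, the factor \<open>0 ^ k\<close> keeps the constant coefficient for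
  \<open>k = 0\<close> only.\<close>

lemma convolution_weighted:
  assumes p: "p \<noteq> 0" "norm p < norm u" "norm u < 1"
  assumes t: "((\<lambda>(i,j). of_int (i + j) ^ k * (cf p i * u powi i * (cf p j * u powi j))) has_sum t) (UNIV \<times> UNIV)"
  shows "t = lamS (Suc k) p u - lamS k p u - 2 * lamH k p u - 0 ^ k * (2 * lam2 (\<lambda>_. 1) p 1)"
proof -
  have u: "u \<noteq> 0" "norm p < 1" using p by auto
  have t': "((\<lambda>(n,i). of_int n ^ k * u powi n * (cf p i * cf p (n - i))) has_sum t) (UNIV \<times> UNIV)"
    using t
  proof (rule has_sum_reindex_bij_witness[THEN iffD1, rotated -1])
    show "(case case x of (i, j) \<Rightarrow> (i + j, i) of (n, i) \<Rightarrow> of_int n ^ k * u powi n * (cf p i * cf p (n - i))) =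
      (case x of (i, j) \<Rightarrow> of_int (i + j) ^ k * (cf p i * u powi i * (cf p j * u powi j)))" for x
      using u by (cases x) (simp add: power_int_add)
    show "(\<lambda>(n, i). (i, n - i)) ((\<lambda>(i, j). (i + j, i)) x) = x" for x :: "int \<times> int" by (cases x) auto
    show "(\<lambda>(i, j). (i + j, i)) ((\<lambda>(n, i). (i, n - i)) x) = x" for x :: "int \<times> int" by (cases x) auto
  qed auto
  have "((\<lambda>n. of_int n ^ k * u powi n * (if n = 0 then - 2 * lam2 (\<lambda>_. 1) p 1 else of_int n * cf p n - cf p n - 2 * hf p n)) has_sum t) UNIV"
  proof (rule has_sum_SigmaD[OF t'])
    show "((\<lambda>i. case (n, i) of (n, i) \<Rightarrow> of_int n ^ k * u powi n * (cf p i * cf p (n - i))) has_sum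
      of_int n ^ k * u powi n * (if n = 0 then - 2 * lam2 (\<lambda>_. 1) p 1 else of_int n * cf p n - cf p n - 2 * hf p n)) UNIV" for n
      unfolding prod.case by (intro has_sum_cmult_right has_sum_cf_convolution p u)
  qed
  moreover have "((\<lambda>n. of_int n ^ k * u powi n * (if n = 0 then - 2 * lam2 (\<lambda>_. 1) p 1 else of_int n * cf p n - cf p n - 2 * hf p n))
      has_sum (lamS (Suc k) p u - lamS k p u - 2 * lamH k p u + 0 ^ k * (- (2 * lam2 (\<lambda>_. 1) p 1)))) UNIV"
  proof -
    have "((\<lambda>n. if n = 0 then 0 ^ k * (- (2 * lam2 (\<lambda>_. 1) p 1)) else 0) has_sum (0 ^ k * (- (2 * lam2 (\<lambda>_. 1) p 1)))) (UNIV :: int set)"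
      by (rule has_sum_finite_neutralI[of "{0}"]) auto
    from has_sum_add[OF has_sum_diff[OF has_sum_diff[OF has_sum_lamS[OF p, of "Suc k"] has_sum_lamS[OF p, of k]]
        has_sum_cmult_right[OF has_sum_lamH[OF p, of k], of 2]] this]
    show ?thesis
      by (rule has_sum_cong[THEN iffD1, rotated]) (auto simp: algebra_simps)
  qed
  ultimately show ?thesis using has_sum_unique by fastforce
qed

subsection \<open>Heat equation and addition formula\<close>

context
  fixes p u :: complex
  assumes p: "p \<noteq> 0" "norm p < norm u" "norm u < 1"
begin

text \<open>This and the next two lemmas are the cases k = 0, 1, 2 of
  \<open>convolution_weighted\<close>. The case k = 1 is the heat equation, k = 0 its antiderivative
  and k = 2 its derivative in \<open>u\<close>. They express \<open>lamH\<close> through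
  \<open>lamS\<close>.\<close>

lemma lamS_0_square:
  "(lamS 0 p u)\<^sup>2 = lamS 1 p u - lamS 0 p u - 2 * lamH 0 p u - 2 * lam2 (\<lambda>_. 1) p 1"
  using convolution_weighted[OF p, of 0 "(lamS 0 p u)\<^sup>2"]
    has_sum_product[OF has_sum_lamS[OF p, of 0] has_sum_lamS[OF p, of 0]]
  by (simp add: power2_eq_square)

lemma lamS_0_times_1:
  "2 * lamS 0 p u * lamS 1 p u = lamS 2 p u - lamS 1 p u - 2 * lamH 1 p u"
proof -
  note s = has_sum_lamS[OF p]
  have "((\<lambda>(i,j). of_int (i + j) ^ 1 * (cf p i * u powi i * (cf p j * u powi j))) has_sum
      (lamS 1 p u * lamS 0 p u + lamS 0 p u * lamS 1 p u)) (UNIV \<times> UNIV)"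
    by (rule has_sum_cong[THEN iffD1, rotated,
          OF has_sum_add[OF has_sum_product[OF s[of 1] s[of 0]] has_sum_product[OF s[of 0] s[of 1]]]])
      (auto simp: algebra_simps)
  from convolution_weighted[OF p this] show ?thesis by (simp add: numeral_2_eq_2 algebra_simps)
qed

lemma lamS_0_times_2:
  "2 * lamS 0 p u * lamS 2 p u + 2 * (lamS 1 p u)\<^sup>2 = lamS 3 p u - lamS 2 p u - 2 * lamH 2 p u"
proof -
  note s = has_sum_lamS[OF p]
  have "((\<lambda>(i,j). of_int (i + j) ^ 2 * (cf p i * u powi i * (cf p j * u powi j))) has_sum
      (lamS 2 p u * lamS 0 p u + 2 * (lamS 1 p u * lamS 1 p u) + lamS 0 p u * lamS 2 p u)) (UNIV \<times> UNIV)"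
    by (rule has_sum_cong[THEN iffD1, rotated,
          OF has_sum_add[OF has_sum_add[OF has_sum_product[OF s[of 2] s[of 0]] 
             has_sum_cmult_right[OF has_sum_product[OF s[of 1] s[of 1]], of 2]] has_sum_product[OF s[of 0] s[of 2]]]])
      (auto simp: algebra_simps power2_eq_square)
  from convolution_weighted[OF p this] show ?thesis
    by (simp add: numeral_2_eq_2 numeral_3_eq_3 algebra_simps)
qed

end

context
  fixes p a b :: complex
  assumes p: "p \<noteq> 0" "norm p < norm (a * b)" "norm a < 1" "norm b < 1"
begin

lemma annulus:
  "a \<noteq> 0" "b \<noteq> 0" "norm p < 1" "norm p < norm a" "norm p < norm b" "norm (a * b) < 1"
proof -
  show ab: "a \<noteq> 0" "b \<noteq> 0" using p by auto
  have "norm a * norm b < norm a * 1" "norm a * norm b < 1 * norm b"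
    using p ab by (intro mult_strict_left_mono mult_strict_right_mono; simp)+
  then show "norm p < 1" "norm p < norm a" "norm p < norm b" "norm (a * b) < 1"
    using p by (auto simp: norm_mult)
qed

lemmas lamS_a = has_sum_lamS[OF p(1) annulus(4) p(3)]
  and lamS_b = has_sum_lamS[OF p(1) annulus(5) p(4)]
  and lamS_ab = has_sum_lamS[OF p(1,2) annulus(6)]
  and lamH_a = has_sum_lamH[OF p(1) annulus(4) p(3)]
  and lamH_b = has_sum_lamH[OF p(1) annulus(5) p(4)]
  and lamH_ab = has_sum_lamH[OF p(1,2) annulus(6)]

lemma three_term_00:
  "lamS 0 p (a * b) * (lamS 0 p a + lamS 0 p b) =
    lamS 0 p a * lamS 0 p b - (lamH 0 p (a * b) + lamS 0 p (a * b)) - lamH 0 p b - lamH 0 p a"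
proof -
  have "lamS 0 p (a * b) * lamS 0 p a + lamS 0 p (a * b) * lamS 0 p b =
    lamS 0 p a * lamS 0 p b - (lamH 0 p (a * b) + lamS 0 p (a * b)) - lamH 0 p b - lamH 0 p a"
    using has_sum_product[OF lamS_ab[of 0] lamS_a[of 0]] has_sum_product[OF lamS_ab[of 0] lamS_b[of 0]]
      has_sum_product[OF lamS_a[of 0] lamS_b[of 0]] has_sum_add[OF lamH_ab[of 0] lamS_ab[of 0]] lamH_b[of 0] lamH_a[of 0]
    by (intro three_term_weighted[OF p(1) annulus(3,1,2), where W = "\<lambda>i j. 1"])
      (simp_all add: algebra_simps)
  then show ?thesis by (simp add: algebra_simps)
qed

lemma three_term_10:
  "lamS 1 p (a * b) * (lamS 0 p a + lamS 0 p b) + lamS 0 p (a * b) * lamS 1 p a =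
    lamS 1 p a * lamS 0 p b - (lamH 1 p (a * b) + lamS 1 p (a * b)) - lamH 1 p a"
proof -
  have "(lamS 1 p (a * b) * lamS 0 p a + lamS 0 p (a * b) * lamS 1 p a) + lamS 1 p (a * b) * lamS 0 p b =
    lamS 1 p a * lamS 0 p b - (lamH 1 p (a * b) + lamS 1 p (a * b)) - 0 - lamH 1 p a"
    using has_sum_add[OF has_sum_product[OF lamS_ab[of 1] lamS_a[of 0]] has_sum_product[OF lamS_ab[of 0] lamS_a[of 1]]]
      has_sum_product[OF lamS_ab[of 1] lamS_b[of 0]]
      has_sum_product[OF lamS_a[of 1] lamS_b[of 0]] has_sum_add[OF lamH_ab[of 1] lamS_ab[of 1]] lamH_a[of 1]
    by (intro three_term_weighted[OF p(1) annulus(3,1,2), where W = "\<lambda>i j. of_int i"])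
      (simp_all add: algebra_simps case_prod_unfold)
  then show ?thesis by (simp add: algebra_simps)
qed

lemma three_term_11:
  "lamS 2 p (a * b) * (lamS 0 p a + lamS 0 p b) + lamS 1 p (a * b) * (lamS 1 p a + lamS 1 p b) =
    lamS 1 p a * lamS 1 p b - (lamH 2 p (a * b) + lamS 2 p (a * b))"
proof -
  have "(lamS 2 p (a * b) * lamS 0 p a + lamS 1 p (a * b) * lamS 1 p a) +
        (lamS 2 p (a * b) * lamS 0 p b + lamS 1 p (a * b) * lamS 1 p b) =
    lamS 1 p a * lamS 1 p b - (lamH 2 p (a * b) + lamS 2 p (a * b)) - 0 - 0"
    using has_sum_add[OF has_sum_product[OF lamS_ab[of 2] lamS_a[of 0]] has_sum_product[OF lamS_ab[of 1] lamS_a[of 1]]]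
      has_sum_add[OF has_sum_product[OF lamS_ab[of 2] lamS_b[of 0]] has_sum_product[OF lamS_ab[of 1] lamS_b[of 1]]]
      has_sum_product[OF lamS_a[of 1] lamS_b[of 1]] has_sum_add[OF lamH_ab[of 2] lamS_ab[of 2]]
    by (intro three_term_weighted[OF p(1) annulus(3,1,2), where W = "\<lambda>i j. of_int i * of_int j"])
      (simp_all add: algebra_simps case_prod_unfold power2_eq_square)
  then show ?thesis by (simp add: algebra_simps)
qed

end

section \<open>The addition formula for \<open>zeta1\<close> and its derivatives\<close>

definition eisP :: "complex \<Rightarrow> complex" where
  "eisP p = 1 - 24 * lam2 (\<lambda>_. 1) p 1"

text \<open>The constant 1/2 completes the square, \<open>lamS 0 p u\<close> squared plus
  \<open>lamS 0 p u\<close> being \<open>zeta1\<close> squared minus 1/4, and so absorbs the lower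
  order terms of the heat equation.\<close>

definition zeta1 :: "complex \<Rightarrow> complex \<Rightarrow> complex" where
  "zeta1 p u = 1 / 2 + lamS 0 p u"

lemma two_zeta1: "2 * zeta1 p u = 1 + 2 * lamS 0 p u"
  by (simp add: zeta1_def)

lemma lamH_0_eq:
  assumes "p \<noteq> 0" "norm p < norm u" "norm u < 1"
  shows "24 * lamH 0 p u = 12 * lamS 1 p u - 12 * (zeta1 p u)\<^sup>2 + 2 + eisP p"
  using lamS_0_square[OF assms] two_zeta1[of p u] eisP_def[of p] by algebra

lemma lamH_1_eq:
  assumes "p \<noteq> 0" "norm p < norm u" "norm u < 1"
  shows "2 * lamH 1 p u = lamS 2 p u - 2 * zeta1 p u * lamS 1 p u"
  using lamS_0_times_1[OF assms] two_zeta1[of p u] by algebra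

lemma lamH_2_eq:
  assumes "p \<noteq> 0" "norm p < norm u" "norm u < 1"
  shows "2 * lamH 2 p u = lamS 3 p u - 2 * zeta1 p u * lamS 2 p u - 2 * (lamS 1 p u)\<^sup>2"
  using lamS_0_times_2[OF assms] two_zeta1[of p u] by algebra

context
  fixes p a b :: complex
  assumes p: "p \<noteq> 0" "norm p < norm (a * b)" "norm a < 1" "norm b < 1"
begin

lemmas lamH_a_eq = lamH_0_eq[OF p(1) annulus(4)[OF p] p(3)] lamH_1_eq[OF p(1) annulus(4)[OF p] p(3)] lamH_2_eq[OF p(1) annulus(4)[OF p] p(3)]
lemmas lamH_b_eq = lamH_0_eq[OF p(1) annulus(5)[OF p] p(4)] lamH_1_eq[OF p(1) annulus(5)[OF p] p(4)] lamH_2_eq[OF p(1) annulus(5)[OF p] p(4)]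
lemmas lamH_ab_eq = lamH_0_eq[OF p(1,2) annulus(6)[OF p]] lamH_1_eq[OF p(1,2) annulus(6)[OF p]] lamH_2_eq[OF p(1,2) annulus(6)[OF p]]

text \<open>Eliminating the three values of \<open>lamH 0\<close> from \<open>three_term_00\<close>
  leaves a perfect square.\<close>

lemma zeta1_addition_square:
  "4 * (zeta1 p a + zeta1 p b - zeta1 p (a * b))\<^sup>2 =
    4 * (lamS 1 p a + lamS 1 p b + lamS 1 p (a * b)) + eisP p"
  using three_term_00[OF p] lamH_a_eq(1) lamH_b_eq(1) lamH_ab_eq(1) two_zeta1[of p a] two_zeta1[of p b] two_zeta1[of p "a * b"]
  by algebra

text \<open>Formally \<open>a d/da\<close> of the preceding formula, obtained instead by eliminating
  \<open>lamH 1\<close> from \<open>three_term_10\<close>.\<close>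

lemma zeta1_addition_deriv:
  "2 * (zeta1 p a + zeta1 p b - zeta1 p (a * b)) * (lamS 1 p a - lamS 1 p (a * b)) = lamS 2 p a + lamS 2 p (a * b)"
  using three_term_10[OF p] lamH_a_eq(2) lamH_ab_eq(2) two_zeta1[of p a] two_zeta1[of p b] two_zeta1[of p "a * b"]
  by algebra

text \<open>Formally \<open>b d/db\<close> of the preceding formula; \<open>lamS 1 p a\<close> and
  \<open>lamS 2 p a\<close> are constant in \<open>b\<close>.\<close>

lemma zeta1_addition_deriv2:
  "2 * (lamS 1 p b - lamS 1 p (a * b)) * (lamS 1 p a - lamS 1 p (a * b)) -
     2 * (zeta1 p a + zeta1 p b - zeta1 p (a * b)) * lamS 2 p (a * b) = lamS 3 p (a * b)"
  using three_term_11[OF p] lamH_ab_eq(3) two_zeta1[of p a] two_zeta1[of p b] two_zeta1[of p "a * b"]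
  by algebra

end

lemma lamS_reflect:
  assumes "p \<noteq> 0" "u \<noteq> 0"
  shows "lamS k p (p / u) = - ((-1) ^ k * lamS k p u)"
proof -
  have "(-1) ^ k * ((-1) ^ k * x) = (x :: complex)" for x
    by (simp flip: mult.assoc power_mult_distrib)
  then show ?thesis using assms by (simp add: lamS_def algebra_simps)
qed

subsection \<open>Infinite products\<close>

text \<open>Sum the double series of w(n) u^n p^(nj) in two ways: over j first, a geometric series
  gives \<open>lam\<close>; over n first gives \<open>f j\<close>. The row n = 0 would diverge in j
  and is removed by \<open>w 0 = 0\<close>.\<close>

lemma lam_swap:
  assumes "subexp w" "norm p < 1" "norm u < 1" "w 0 = 0"
  assumes f: "\<And>j. (\<lambda>n. w n * (u * p ^ j) ^ n) sums f j"
  shows "f sums lam w p u"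
proof -
  let ?g = "\<lambda>(n, j). w n * u ^ n * (p ^ n) ^ j"
  have geo: "((\<lambda>j. w n * u ^ n * (p ^ n) ^ j) has_sum (w n * u ^ n / (1 - p ^ n))) UNIV" for n
  proof (cases "n = 0")
    case False
    have "norm (p ^ n) < 1" using assms False by (simp add: norm_power power_less_one_iff)
    then have "((\<lambda>j. (p ^ n) ^ j) has_sum (1 / (1 - p ^ n))) UNIV"
      by (intro norm_summable_imp_has_sum geometric_sums) (simp add: norm_power)
    from has_sum_cmult_right[OF this, of "w n * u ^ n"] show ?thesis by simp
  qed (simp add: assms)
  have geo': "((\<lambda>j. norm (w n * u ^ n * (p ^ n) ^ j)) has_sum (norm (w n * u ^ n) / (1 - norm p ^ n))) UNIV" for n
  proof (cases "n = 0")
    case False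
    have "norm p ^ n < 1" using assms False by (simp add: power_less_one_iff)
    then have "((\<lambda>j. (norm p ^ n) ^ j) has_sum (1 / (1 - norm p ^ n))) UNIV"
      by (intro norm_summable_imp_has_sum geometric_sums) (simp_all add: norm_power)
    from has_sum_cmult_right[OF this, of "norm (w n * u ^ n)"] show ?thesis
      by (simp add: norm_mult norm_power)
  qed (simp add: assms)
  \<comment> \<open>Absolute convergence of the double series is the convergence of the Lambert
    series for the norms of \<open>w\<close>, \<open>p\<close> and \<open>u\<close>.\<close>
  have "subexp (\<lambda>n. of_real (norm (w n)))" using assms(1) by (simp add: subexp_def)
  from summable_lam[OF this, of "of_real (norm p)" "of_real (norm u)"] assms
  have "summable (\<lambda>n. norm (of_real (norm (w n)) * of_real (norm u) ^ n / (1 - of_real (norm p) ^ n) :: complex))"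
    by simp
  moreover have "of_real (norm (w n)) * of_real (norm u) ^ n / (1 - of_real (norm p) ^ n) =
      (of_real (norm (w n * u ^ n) / (1 - norm p ^ n)) :: complex)" for n
    by (simp add: norm_mult norm_power)
  ultimately have "summable (\<lambda>n. norm (norm (w n * u ^ n) / (1 - norm p ^ n)))"
    by (simp only: norm_of_real real_norm_def)
  then have "(\<lambda>n. norm (w n * u ^ n) / (1 - norm p ^ n)) summable_on UNIV"
    by (rule norm_summable_imp_summable_on)
  then have "(\<lambda>x. norm (?g x)) summable_on (UNIV \<times> UNIV)"
  proof (rule summable_on_SigmaI[rotated])
    show "((\<lambda>j. norm (?g (n, j))) has_sum norm (w n * u ^ n) / (1 - norm p ^ n)) UNIV" for n
      unfolding prod.case by (rule geo')
  qed simp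
  then have g: "?g summable_on (UNIV \<times> UNIV)"
    by (rule summable_on_iff_abs_summable_on_complex[THEN iffD2])
  have l: "((\<lambda>n. w n * u ^ n / (1 - p ^ n)) has_sum lam w p u) UNIV"
    unfolding lam_def
    by (rule norm_summable_imp_has_sum[OF summable_lam summable_sums[OF summable_norm_cancel[OF summable_lam]]])
      (rule assms)+
  have "(?g has_sum lam w p u) (UNIV \<times> UNIV)"
  proof (rule has_sum_SigmaI[OF _ l g])
    show "((\<lambda>j. ?g (n, j)) has_sum w n * u ^ n / (1 - p ^ n)) UNIV" for n
      unfolding prod.case by (rule geo)
  qed
  then have g': "((\<lambda>(j, n). w n * u ^ n * (p ^ n) ^ j) has_sum lam w p u) (UNIV \<times> UNIV)"
    by (subst (asm) has_sum_swap) (simp add: case_prod_unfold)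
  have "((\<lambda>n. w n * u ^ n * (p ^ n) ^ j) has_sum f j) UNIV" for j
  proof -
    have "(\<lambda>n. w n * u ^ n * (p ^ n) ^ j) summable_on UNIV"
      using g' by (intro summable_on_SigmaD1[where A=UNIV and B="\<lambda>_. UNIV" and f = "\<lambda>j n. w n * u ^ n * (p ^ n) ^ j"]) (auto simp: summable_on_def)
    then obtain s where s: "((\<lambda>n. w n * u ^ n * (p ^ n) ^ j) has_sum s) UNIV" by (auto simp: summable_on_def)
    have "w n * u ^ n * (p ^ n) ^ j = w n * (u * p ^ j) ^ n" for n
    proof -
      have "(p ^ n) ^ j = (p ^ j) ^ n" by (metis mult.commute power_mult)
      then show ?thesis by (simp add: power_mult_distrib)
    qed
    with has_sum_imp_sums[OF s] have "(\<lambda>n. w n * (u * p ^ j) ^ n) sums s" by simp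
    then have "s = f j" using f[of j] by (rule sums_unique2)
    with s show ?thesis by simp
  qed
  then have "(f has_sum lam w p u) UNIV"
    by (intro has_sum_SigmaD[OF g']) (simp only: prod.case)
  then show ?thesis by (rule has_sum_imp_sums)
qed

text \<open>The two Lambert forms of E_2, with terms n p^n / (1 - p^n) and p^j / (1 - p^j)^2; this
  identifies \<open>eisP\<close> with \<open>E2\<close>.\<close>

lemma lam_id_eq_lam2:
  assumes "norm p < 1"
  shows "lam of_nat p p = lam2 (\<lambda>_. 1) p 1"
proof -
  have *: "(\<lambda>n. of_nat n * (p * p ^ j) ^ n) sums (p ^ Suc j / (1 - p ^ Suc j)\<^sup>2)" for j
  proof -
    have "norm (p * p ^ j) < 1" using assms by (simp add: power_less_one_iff flip: power_Suc norm_power norm_mult) (simp add: norm_power power_less_one_iff del: power_Suc)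
    from geometric_deriv_sums[OF this] have "(\<lambda>n. of_nat (Suc n) * (p * p ^ j) ^ n) sums (1 / (1 - p * p ^ j)\<^sup>2)" .
    from sums_mult[OF this, of "p * p ^ j"] have "(\<lambda>n. of_nat (Suc n) * (p * p ^ j) ^ Suc n) sums (p * p ^ j / (1 - p * p ^ j)\<^sup>2)"
      by (simp add: mult_ac)
    then show ?thesis by (subst (asm) sums_Suc_iff) simp
  qed
  have "subexp of_nat" using subexp_power[of 1] by simp
  from lam_swap[OF this assms assms _ *]
  have "(\<lambda>j. p ^ Suc j / (1 - p ^ Suc j)\<^sup>2) sums lam of_nat p p" by simp
  then have "(\<lambda>j. p ^ j / (1 - p ^ j)\<^sup>2) sums lam of_nat p p"
    by (subst (asm) sums_Suc_iff) simp
  then show ?thesis by (simp add: lam2_def sums_iff)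
qed

text \<open>Sum the logarithm series of all factors and exchange the order. The exponential form
  gives nonvanishing and the logarithmic derivative at once.\<close>

lemma qpoch_eq_exp:
  assumes "norm p < 1" "norm u < 1"
  shows "qpoch u p = exp (- lam (\<lambda>n. 1 / of_nat n) p u)"
proof -
  have *: "norm (u * p ^ j) < 1" for j
  proof -
    have "norm u * norm p ^ j \<le> norm u * 1" using assms by (intro mult_left_mono) (auto simp: power_le_one)
    then show ?thesis using assms by (simp add: norm_mult norm_power)
  qed
  have "(\<lambda>n. 1 / of_nat n * (u * p ^ j) ^ n) sums (- Ln (1 - u * p ^ j))" for j
    using sums_minus[OF Ln_series'[of "- (u * p ^ j)"]] *[of j] by simp
  from lam_swap[OF subexp_inverse assms _ this]
  have "(\<lambda>j. - Ln (1 - u * p ^ j)) sums lam (\<lambda>n. 1 / of_nat n) p u" by simp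
  then have s: "(\<lambda>j. Ln (1 - u * p ^ j)) sums (- lam (\<lambda>n. 1 / of_nat n) p u)"
    using sums_minus by fastforce
  have "1 - u * p ^ j \<noteq> 0" for j using *[of j] by auto
  then have "qpoch u p = (\<Prod>j. exp (Ln (1 - u * p ^ j)))" by (simp add: qpoch_def)
  also have "\<dots> = exp (\<Sum>j. Ln (1 - u * p ^ j))"
    using s by (intro prodinf_exp) (auto simp: sums_iff)
  finally show ?thesis using s by (simp add: sums_iff)
qed

subsection \<open>The derivation \<open>q d/dq\<close>\<close>

text \<open>Records differentiability together with the value of \<open>q d/dq\<close>. At q = 0
  that value is always 0.\<close>

definition has_qderiv :: "(complex \<Rightarrow> complex) \<Rightarrow> complex \<Rightarrow> complex \<Rightarrow> bool" where
  "has_qderiv f d q \<longleftrightarrow> (\<exists>D. (f has_field_derivative D) (at q) \<and> q * D = d)"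

lemma has_qderiv_const [simp]: "has_qderiv (\<lambda>_. c) 0 q"
  unfolding has_qderiv_def by (intro exI[of _ 0]) auto

lemma has_qderiv_ident: "has_qderiv (\<lambda>q. q) q q"
  unfolding has_qderiv_def by (intro exI[of _ 1]) auto

lemma has_qderiv_add:
  assumes "has_qderiv f d q" "has_qderiv g e q"
  shows "has_qderiv (\<lambda>q. f q + g q) (d + e) q"
  using assms unfolding has_qderiv_def by (auto intro!: derivative_eq_intros simp: algebra_simps)

lemma has_qderiv_mult:
  assumes "has_qderiv f d q" "has_qderiv g e q"
  shows "has_qderiv (\<lambda>q. f q * g q) (d * g q + f q * e) q"
  using assms unfolding has_qderiv_def by (auto intro!: derivative_eq_intros simp: algebra_simps)

lemma has_qderiv_cmult:
  assumes "has_qderiv f d q"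
  shows "has_qderiv (\<lambda>q. c * f q) (c * d) q"
  using has_qderiv_mult[OF has_qderiv_const[of c] assms] by simp

lemma has_qderiv_diff:
  assumes "has_qderiv f d q" "has_qderiv g e q"
  shows "has_qderiv (\<lambda>q. f q - g q) (d - e) q"
  using has_qderiv_add[OF assms(1) has_qderiv_cmult[OF assms(2), of "-1"]] by simp

lemma has_qderiv_exp:
  assumes "has_qderiv f d q"
  shows "has_qderiv (\<lambda>q. exp (f q)) (exp (f q) * d) q"
  using assms unfolding has_qderiv_def by (auto intro!: derivative_eq_intros)

lemma has_qderiv_imp_deriv:
  assumes "has_qderiv f d q"
  shows "f field_differentiable at q" "q * deriv f q = d"
  using assms unfolding has_qderiv_def by (auto simp: field_differentiable_def DERIV_imp_deriv)

lemma has_qderiv_cong_ev: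
  assumes "has_qderiv f d q" "open S" "q \<in> S" "\<And>x. x \<in> S \<Longrightarrow> f x = g x"
  shows "has_qderiv g d q"
  using assms has_field_derivative_transform_within_open[of f _ q S g] unfolding has_qderiv_def by blast

text \<open>The ordinary derivative of the n-th term, not \<open>q d/dq\<close> of it, because
  \<open>zeta7_at_0\<close> needs its value at q = 0.\<close>

definition dlam_term :: "(nat \<Rightarrow> complex) \<Rightarrow> nat \<Rightarrow> nat \<Rightarrow> complex \<Rightarrow> complex" where
  "dlam_term w b n q = w n * (of_nat (b * n) * q ^ (b * n - 1) / (1 - q ^ (7 * n)) +
     of_nat (7 * n) * q ^ (b * n) * q ^ (7 * n - 1) / (1 - q ^ (7 * n))\<^sup>2)"

lemma has_field_derivative_lam:
  assumes w: "subexp w" and q: "norm q < 1" and b: "b \<ge> 1"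
  shows "((\<lambda>q. lam w (q ^ 7) (q ^ b)) has_field_derivative (\<Sum>n. dlam_term w b n q)) (at q)"
    and "summable (\<lambda>n. dlam_term w b n q)"
proof -
  \<comment> \<open>A radius strictly between \<open>norm q\<close> and 1: on the disc of radius
    \<open>r\<close> all powers of \<open>x\<close> that occur are bounded by \<open>r\<close>,
    which gives one summable majorant.\<close>
  define r where "r = (1 + norm q) / 2"
  have r: "norm q < r" "r < 1" "0 \<le> r" using q by (auto simp: r_def add_nonneg_nonneg)
  let ?f = "\<lambda>n q. w n * (q ^ b) ^ n / (1 - (q ^ 7) ^ n)"
  have pw: "norm (x ^ m) \<le> r" if "norm x < r" "m \<ge> 1" for x :: complex and m
  proof -
    have "norm x ^ m \<le> norm x ^ 1" using that r by (intro power_decreasing) auto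
    then show ?thesis using that by (simp add: norm_power)
  qed
  have "summable (\<lambda>n. norm (w n) * r ^ n * inverse (1 - r))"
    using w r by (intro summable_mult2) (auto simp: subexp_def)
  moreover have "(?f n has_field_derivative dlam_term w b n x) (at x)" if "x \<in> ball 0 r" for n x
  proof (cases "n = 0")
    case False
    have "norm (x ^ (7 * n)) < 1" using pw[of x "7 * n"] that r False by simp
    then have "x ^ (7 * n) \<noteq> 1" by auto
    then have "((\<lambda>q. w n * q ^ (b * n) / (1 - q ^ (7 * n))) has_field_derivative dlam_term w b n x) (at x)"
      unfolding dlam_term_def
      by (auto intro!: derivative_eq_intros simp: divide_simps) (simp add: algebra_simps power2_eq_square)
    then show ?thesis by (simp flip: power_mult)
  qed (simp add: dlam_term_def)
  moreover have "\<forall>\<^sub>F n in sequentially. \<forall>x\<in>ball 0 r. norm (?f n x) \<le> norm (w n) * r ^ n * inverse (1 - r)"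
    using pw b r by (intro always_eventually allI ballI lam_term_bound) auto
  ultimately obtain g g' where g: "\<forall>x \<in> ball 0 r. (\<lambda>n. ?f n x) sums g x \<and>
      (\<lambda>n. dlam_term w b n x) sums g' x \<and> (g has_field_derivative g' x) (at x)"
    using series_and_derivative_comparison[where S = "ball 0 r" and f = ?f and f' = "dlam_term w b", OF open_ball]
    by blast
  have qr: "q \<in> ball 0 r" using r by simp
  have eq: "g x = lam w (x ^ 7) (x ^ b)" if "x \<in> ball 0 r" for x
    unfolding lam_def using g that by (blast intro: sums_unique)
  have "(g has_field_derivative g' q) (at q)" using g qr by blast
  then have "((\<lambda>q. lam w (q ^ 7) (q ^ b)) has_field_derivative g' q) (at q)"
    by (rule has_field_derivative_transform_within_open[OF _ open_ball qr eq])
  moreover have "(\<lambda>n. dlam_term w b n q) sums g' q" using g qr by blast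
  then have "g' q = (\<Sum>n. dlam_term w b n q)" "summable (\<lambda>n. dlam_term w b n q)"
    by (simp_all add: sums_iff)
  ultimately show "((\<lambda>q. lam w (q ^ 7) (q ^ b)) has_field_derivative (\<Sum>n. dlam_term w b n q)) (at q)"
    and "summable (\<lambda>n. dlam_term w b n q)" by simp_all
qed

lemma norm_power_less_one:
  fixes q :: complex
  assumes "norm q < 1" "b \<ge> 1"
  shows "norm (q ^ b) < 1"
  using assms by (simp add: norm_power power_less_one_iff)

text \<open>With u = q^b and p = q^7, \<open>q d/dq\<close> is \<open>b\<close> times
  \<open>u d/du\<close> plus 7 times \<open>p d/dp\<close>; the latter maps 1/(1 - p^n) to n p^n /
  (1 - p^n)^2.\<close>

lemma has_qderiv_lam:
  assumes w: "subexp w" and q: "norm q < 1" and b: "b \<ge> 1"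
  shows "has_qderiv (\<lambda>q. lam w (q ^ 7) (q ^ b))
    (of_nat b * lam (\<lambda>n. of_nat n * w n) (q ^ 7) (q ^ b) + 7 * lam2 (\<lambda>n. of_nat n * w n) (q ^ 7) (q ^ b)) q"
proof -
  let ?w = "\<lambda>n. of_nat n * w n"
  have 0: "norm (q ^ 7) < 1" "norm (q ^ b) < 1" "norm (q ^ 7 * q ^ b) < 1"
    using norm_power_less_one[OF q, of 7] norm_power_less_one[OF q, of b] norm_power_less_one[OF q, of "7 + b"] b
    by (simp_all add: power_add)
  have s: "summable (\<lambda>n. ?w n * (q ^ b) ^ n / (1 - (q ^ 7) ^ n))"
    "summable (\<lambda>n. ?w n * (q ^ 7 * q ^ b) ^ n / (1 - (q ^ 7) ^ n)\<^sup>2)"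
    by (rule summable_norm_cancel, rule summable_lam summable_lam2; (rule subexp_times_n w 0)+)+
  have *: "q * dlam_term w b n q = of_nat b * (?w n * (q ^ b) ^ n / (1 - (q ^ 7) ^ n)) +
      7 * (?w n * (q ^ 7 * q ^ b) ^ n / (1 - (q ^ 7) ^ n)\<^sup>2)" for n
  proof (cases "n = 0")
    case False
    have a: "q * q ^ (b * n - 1) = (q ^ b) ^ n" "q * q ^ (7 * n - 1) = (q ^ 7) ^ n"
      using False b by (simp_all flip: power_mult power_Suc)
    have "q * dlam_term w b n q = w n * (of_nat (b * n) * (q * q ^ (b * n - 1)) / (1 - q ^ (7 * n)) +
     of_nat (7 * n) * q ^ (b * n) * (q * q ^ (7 * n - 1)) / (1 - q ^ (7 * n))\<^sup>2)"
      by (simp add: dlam_term_def algebra_simps)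
    then show ?thesis unfolding a power_mult
      by (simp add: algebra_simps power_mult_distrib)
  qed (simp add: dlam_term_def)
  have "q * (\<Sum>n. dlam_term w b n q) = (\<Sum>n. q * dlam_term w b n q)"
    using has_field_derivative_lam(2)[OF assms] by (simp add: suminf_mult)
  also have "\<dots> = of_nat b * lam ?w (q ^ 7) (q ^ b) + 7 * lam2 ?w (q ^ 7) (q ^ b)"
    unfolding * lam_def lam2_def
    by (subst suminf_add[OF summable_mult[OF s(1)] summable_mult[OF s(2)], symmetric])
      (simp only: suminf_mult[OF s(1)] suminf_mult[OF s(2)])
  finally show ?thesis
    using has_field_derivative_lam(1)[OF assms] unfolding has_qderiv_def by blast
qed

lemma power_7_divide:
  fixes q :: complex
  assumes "1 \<le> a" "a \<le> 6"
  shows "q ^ 7 / q ^ a = q ^ (7 - a)"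
  using assms by (cases "q = 0") (auto simp: power_diff)

lemma lamS_power:
  assumes "1 \<le> a" "a \<le> 6"
  shows "lamS k (q ^ 7) (q ^ a) = lam (\<lambda>n. of_nat n ^ k) (q ^ 7) (q ^ a) -
    (-1) ^ k * lam (\<lambda>n. of_nat n ^ k) (q ^ 7) (q ^ (7 - a))"
  unfolding lamS_def power_7_divide[OF assms] ..

text \<open>The negative half is differentiated with exponent 7 - a. Its part -a completes
  \<open>lamS\<close>, and its part 7 is the extra \<open>lam\<close> term in
  \<open>lamH\<close>.\<close>

lemma has_qderiv_lamS:
  assumes q: "norm q < 1" and a: "1 \<le> a" "a \<le> 6"
  shows "has_qderiv (\<lambda>q. lamS k (q ^ 7) (q ^ a))
    (of_nat a * lamS (Suc k) (q ^ 7) (q ^ a) + 7 * lamH (Suc k) (q ^ 7) (q ^ a)) q"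
proof -
  have "has_qderiv (\<lambda>q. lamS k (q ^ 7) (q ^ a))
    (of_nat a * lam (\<lambda>n. of_nat n * of_nat n ^ k) (q ^ 7) (q ^ a) + 7 * lam2 (\<lambda>n. of_nat n * of_nat n ^ k) (q ^ 7) (q ^ a) -
      (-1) ^ k * (of_nat (7 - a) * lam (\<lambda>n. of_nat n * of_nat n ^ k) (q ^ 7) (q ^ (7 - a)) +
        7 * lam2 (\<lambda>n. of_nat n * of_nat n ^ k) (q ^ 7) (q ^ (7 - a)))) q"
    unfolding lamS_power[OF a]
    using a by (intro has_qderiv_diff has_qderiv_cmult has_qderiv_lam subexp_power q) auto
  moreover have "of_nat (7 - a) = (7 - of_nat a :: complex)" using a by simp
  ultimately show ?thesis
    unfolding lamS_def lamH_def power_7_divide[OF a] by (simp add: algebra_simps)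
qed

text \<open>Simplifies the logarithmic derivative of (p;p) in \<open>has_qderiv_thetaq\<close> to a
  multiple of the series in \<open>eisP\<close>.\<close>

lemma lam_one_add_lam2_one:
  assumes "norm p < 1"
  shows "lam (\<lambda>_. 1) p p + lam2 (\<lambda>_. 1) p p = lam2 (\<lambda>_. 1) p 1"
proof -
  have "norm (p * p) < 1" using norm_power_less_one[OF assms, of 2] by (simp add: power2_eq_square)
  then have s: "summable (\<lambda>n. 1 * p ^ n / (1 - p ^ n))" "summable (\<lambda>n. 1 * (p * p) ^ n / (1 - p ^ n)\<^sup>2)"
    using assms
    by (intro summable_norm_cancel[OF summable_lam[OF subexp_one]] summable_norm_cancel[OF summable_lam2[OF subexp_one]]; simp)+
  have "1 * p ^ n / (1 - p ^ n) + 1 * (p * p) ^ n / (1 - p ^ n)\<^sup>2 = 1 * (p * 1) ^ n / (1 - p ^ n)\<^sup>2" for n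
  proof (cases "p ^ n = 1")
    case False
    then show ?thesis by (simp add: divide_simps power_mult_distrib) (simp add: algebra_simps power2_eq_square)
  qed simp
  then show ?thesis
    unfolding lam_def lam2_def by (subst suminf_add[OF s]) simp
qed

lemma has_qderiv_qpoch:
  assumes q: "norm q < 1" and b: "b \<ge> 1"
  shows "has_qderiv (\<lambda>q. qpoch (q ^ b) (q ^ 7)) (qpoch (q ^ b) (q ^ 7) *
    - (of_nat b * lam (\<lambda>_. 1) (q ^ 7) (q ^ b) + 7 * lam2 (\<lambda>_. 1) (q ^ 7) (q ^ b))) q"
proof -
  have eq: "qpoch (x ^ b) (x ^ 7) = exp (- lam (\<lambda>n. 1 / of_nat n) (x ^ 7) (x ^ b))" if "norm x < 1" for x
    using that b by (intro qpoch_eq_exp norm_power_less_one) auto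
  \<comment> \<open>The weights differ at n = 0 only, where the summand is a division by 0 and
    vanishes in both series.\<close>
  have "lam (\<lambda>n. of_nat n * (1 / of_nat n)) p u = lam (\<lambda>_. 1) p u"
    "lam2 (\<lambda>n. of_nat n * (1 / of_nat n)) p u = lam2 (\<lambda>_. 1) p u" for p u
    unfolding lam_def lam2_def by (intro suminf_cong; case_tac "n = 0"; simp)+
  with has_qderiv_exp[OF has_qderiv_cmult[OF has_qderiv_lam[OF subexp_inverse q b], of "-1"]]
  have "has_qderiv (\<lambda>q. exp (- lam (\<lambda>n. 1 / of_nat n) (q ^ 7) (q ^ b)))
    (exp (- lam (\<lambda>n. 1 / of_nat n) (q ^ 7) (q ^ b)) *
    - (of_nat b * lam (\<lambda>_. 1) (q ^ 7) (q ^ b) + 7 * lam2 (\<lambda>_. 1) (q ^ 7) (q ^ b))) q"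
    by simp
  then show ?thesis unfolding eq[OF q, symmetric]
    by (rule has_qderiv_cong_ev[where S = "ball 0 1"]) (use q eq in auto)
qed

lemma qpoch_nonzero:
  assumes "norm q < 1" "b \<ge> 1"
  shows "qpoch (q ^ b) (q ^ 7) \<noteq> 0"
  using assms by (subst qpoch_eq_exp) (auto intro!: norm_power_less_one)

text \<open>The Jacobi theta product (u, p/u; p) at u = q^a and p = q^7, without its factor
  (p;p).\<close>

definition theta7 :: "nat \<Rightarrow> complex \<Rightarrow> complex" where
  "theta7 a q = qpoch (q ^ a) (q ^ 7) * qpoch (q ^ (7 - a)) (q ^ 7)"

lemma theta7_nonzero:
  assumes "norm q < 1" "1 \<le> a" "a \<le> 6"
  shows "theta7 a q \<noteq> 0"
  using assms by (simp add: theta7_def qpoch_nonzero)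

text \<open>The two factors supply the positive and the negative halves of the bilateral
  sums.\<close>

lemma has_qderiv_theta7:
  assumes q: "norm q < 1" and a: "1 \<le> a" "a \<le> 6"
  shows "has_qderiv (theta7 a) (theta7 a q *
    - (of_nat a * lamS 0 (q ^ 7) (q ^ a) + 7 * lamH 0 (q ^ 7) (q ^ a))) q"
proof -
  have c: "of_nat (7 - a) = (7 - of_nat a :: complex)" using a by simp
  have "7 - a \<ge> 1" using a by simp
  from has_qderiv_mult[OF has_qderiv_qpoch[OF q a(1)] has_qderiv_qpoch[OF q this]]
  show ?thesis
    unfolding theta7_def[abs_def] lamS_def lamH_def power_7_divide[OF a] c by (simp add: algebra_simps)
qed

lemma has_qderiv_quotient:
  assumes "norm q < 1" "has_qderiv f (f q * l) q" "has_qderiv g (g q * m) q" "g q \<noteq> 0"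
  shows "has_qderiv (\<lambda>q. f q / g q) (f q / g q * (l - m)) q"
proof -
  obtain D E where "(f has_field_derivative D) (at q)" "(g has_field_derivative E) (at q)"
    and *: "q * D = f q * l" "q * E = g q * m"
    using assms by (auto simp: has_qderiv_def)
  then have "((\<lambda>q. f q / g q) has_field_derivative ((D * g q - f q * E) / (g q * g q))) (at q)"
    using assms by (intro DERIV_divide)
  moreover have "q * ((D * g q - f q * E) / (g q * g q)) = ((q * D) * g q - f q * (q * E)) / (g q * g q)"
    by (simp add: algebra_simps)
  then have "q * ((D * g q - f q * E) / (g q * g q)) = f q / g q * (l - m)"
    unfolding * using assms by (simp add: divide_simps) (simp add: algebra_simps)
  ultimately show ?thesis unfolding has_qderiv_def by blast
qed

text \<open>The common shape of the three quotients: \<open>x7\<close>, \<open>y7\<close>,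
  \<open>z7\<close> are \<open>q\<close>, \<open>- q\<close>, \<open>1\<close> times the cases
  (2,3), (1,2), (3,1).\<close>

definition thetaq :: "nat \<Rightarrow> nat \<Rightarrow> complex \<Rightarrow> complex" where
  "thetaq a b q = theta7 a q * (qpoch (q ^ 7) (q ^ 7))\<^sup>2 / (theta7 b q)\<^sup>2"

lemma thetaq_nonzero:
  assumes "norm q < 1" "1 \<le> a" "a \<le> 6" "1 \<le> b" "b \<le> 6"
  shows "thetaq a b q \<noteq> 0"
  using assms theta7_nonzero[of q] qpoch_nonzero[of q 7] by (simp add: thetaq_def)

lemma has_qderiv_thetaq:
  assumes q: "norm q < 1" and ab: "1 \<le> a" "a \<le> 6" "1 \<le> b" "b \<le> 6"
  shows "has_qderiv (thetaq a b) (thetaq a b q *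
    (2 * (of_nat b * lamS 0 (q ^ 7) (q ^ b) + 7 * lamH 0 (q ^ 7) (q ^ b))
      - (of_nat a * lamS 0 (q ^ 7) (q ^ a) + 7 * lamH 0 (q ^ 7) (q ^ a))
      - 14 * lam2 (\<lambda>_. 1) (q ^ 7) 1)) q"
proof -
  note E = has_qderiv_qpoch[OF q, of 7, simplified]
  have E': "has_qderiv (\<lambda>q. qpoch (q ^ 7) (q ^ 7)) (qpoch (q ^ 7) (q ^ 7) * (- 7 * lam2 (\<lambda>_. 1) (q ^ 7) 1)) q"
    using E norm_power_less_one[OF q, of 7] by (simp flip: lam_one_add_lam2_one add: algebra_simps)
  define l m s where "l = - (of_nat a * lamS 0 (q ^ 7) (q ^ a) + 7 * lamH 0 (q ^ 7) (q ^ a))"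
    and "m = - (of_nat b * lamS 0 (q ^ 7) (q ^ b) + 7 * lamH 0 (q ^ 7) (q ^ b))"
    and "s = - 7 * lam2 (\<lambda>_. 1) (q ^ 7) 1"
  have sq: "has_qderiv (\<lambda>q. (f q)\<^sup>2) ((f q)\<^sup>2 * (2 * k)) q" if "has_qderiv f (f q * k) q" for f k
    using has_qderiv_mult[OF that that] by (simp add: power2_eq_square algebra_simps)
  have "has_qderiv (\<lambda>q. theta7 a q * (qpoch (q ^ 7) (q ^ 7))\<^sup>2) (theta7 a q * (qpoch (q ^ 7) (q ^ 7))\<^sup>2 * (l + 2 * s)) q"
    using has_qderiv_mult[OF has_qderiv_theta7[OF q ab(1,2), folded l_def] sq[OF E'[folded s_def]]]
    by (simp add: algebra_simps)
  from has_qderiv_quotient[OF q this sq[OF has_qderiv_theta7[OF q ab(3,4), folded m_def]]]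
  have "has_qderiv (thetaq a b) (thetaq a b q * (l + 2 * s - 2 * m)) q"
    using theta7_nonzero[OF q ab(3,4)] by (simp add: thetaq_def[abs_def])
  then show ?thesis by (simp add: l_def m_def s_def algebra_simps)
qed

lemma P7_eq:
  assumes "norm q < 1"
  shows "P7 q = eisP (q ^ 7)"
proof -
  have p: "norm (q ^ 7) < 1" using assms by (rule norm_power_less_one) simp
  let ?f = "\<lambda>n. of_nat n * (q ^ 7) ^ n / (1 - (q ^ 7) ^ n)"
  have "subexp of_nat" using subexp_power[of 1] by simp
  then have "summable ?f" using p by (intro summable_norm_cancel[OF summable_lam])
  then have "(\<Sum>k. ?f (Suc k)) = lam of_nat (q ^ 7) (q ^ 7)"
    unfolding lam_def by (subst suminf_split_head) auto
  then show ?thesis using lam_id_eq_lam2[OF p] by (simp add: P7_def E2_def eisP_def)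
qed

text \<open>The quotient has derivative 0 on the punctured disc and extends continuously to 0 with
  value 1, so it is constantly 1.\<close>

lemma eq_of_log_qderiv:
  assumes f: "\<And>q. q \<noteq> 0 \<Longrightarrow> norm q < 1 \<Longrightarrow> has_qderiv f (f q * l q) q"
    and g: "\<And>q. q \<noteq> 0 \<Longrightarrow> norm q < 1 \<Longrightarrow> has_qderiv g (g q * l q) q"
    and nz: "\<And>q. q \<noteq> 0 \<Longrightarrow> norm q < 1 \<Longrightarrow> g q \<noteq> 0"
    and lim: "((\<lambda>q. f q / g q) \<longlongrightarrow> 1) (at 0)"
    and q: "q \<noteq> 0" "norm q < 1"
  shows "f q = g q"
proof -
  define k where "k x = (if x = 0 then 1 else f x / g x)" for x
  have d: "(k has_field_derivative 0) (at x)" if "x \<in> ball 0 1 - {0}" for x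
  proof -
    have x: "x \<noteq> 0" "norm x < 1" using that by auto
    from has_qderiv_quotient[OF x(2) f[OF x] g[OF x] nz[OF x]]
    have "((\<lambda>q. f q / g q) has_field_derivative 0) (at x)"
      using x by (auto simp: has_qderiv_def)
    then show ?thesis
      by (rule has_field_derivative_transform_within_open[of _ _ _ "- {0}"]) (use x in \<open>auto simp: k_def\<close>)
  qed
  have "isCont k x" if "x \<in> ball 0 1" for x
  proof (cases "x = 0")
    case True
    have "(k \<longlongrightarrow> 1) (at 0)"
      by (rule Lim_transform_eventually[OF lim]) (auto simp: k_def eventually_at_filter)
    then show ?thesis using True by (simp add: isCont_def k_def)
  next
    case False
    then show ?thesis using d[of x] that DERIV_isCont by blast
  qed
  then have "continuous_on (ball 0 1) k"
    by (simp add: continuous_at_imp_continuous_on)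
  then obtain c where c: "\<And>x. x \<in> ball 0 1 \<Longrightarrow> k x = c"
    using DERIV_zero_connected_constant[of "ball 0 1" "{0}" k] d by auto
  have "k q = k 0" using c[of q] c[of 0] q by simp
  then show ?thesis using q nz[OF q] by (simp add: k_def)
qed

subsection \<open>Elimination at level 7\<close>

text \<open>
  \<open>e\<^sub>a\<close>, \<open>A\<^sub>a\<close>, \<open>C\<^sub>a\<close>, \<open>F\<^sub>a\<close> stand for the values of \<open>\<zeta>\<close> (shifted by \<open>-a/7\<close>), \<open>\<wp>\<close>, \<open>\<wp>'\<close>, \<open>\<wp>''\<close> at \<open>q\<^sup>a\<close>, and \<open>d\<^sub>a\<close>, \<open>a\<^sub>a\<close> for
  the derivatives of \<open>e\<^sub>a\<close>, \<open>A\<^sub>a\<close>. The quadratic relation in the conclusion is \<open>xy + yz + zx = 0\<close>.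
\<close>

lemma level_7_elimination:
  fixes e1 e2 e3 A1 A2 A3 C1 C2 C3 P :: complex
  assumes r: "4 * (2 * e1 - e2)\<^sup>2 = 4 * (2 * A1 + A2) + P"
      "4 * (2 * e2 + e3)\<^sup>2 = 4 * (2 * A2 + A3) + P"
      "4 * (2 * e3 + e1)\<^sup>2 = 4 * (2 * A3 + A1) + P"
      "4 * (e1 + e2 - e3)\<^sup>2 = 4 * (A1 + A2 + A3) + P"
    and c: "2 * (2 * e1 - e2) * (A1 - A2) = C1 + C2"
      "2 * (2 * e2 + e3) * (A2 - A3) = C2 - C3"
      "2 * (2 * e3 + e1) * (A3 - A1) = C3 - C1"
  shows "e1\<^sup>2 + e2\<^sup>2 + e3\<^sup>2 - 5 * e1 * e2 + 5 * e2 * e3 + 5 * e1 * e3 = 0"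
    and "36 * A1 = 4 * (4 * (2 * e1 - e2)\<^sup>2 - 2 * (2 * e2 + e3)\<^sup>2 + (2 * e3 + e1)\<^sup>2) - 3 * P"
    and "36 * A2 = 4 * (4 * (2 * e2 + e3)\<^sup>2 - 2 * (2 * e3 + e1)\<^sup>2 + (2 * e1 - e2)\<^sup>2) - 3 * P"
    and "36 * A3 = 4 * (4 * (2 * e3 + e1)\<^sup>2 - 2 * (2 * e1 - e2)\<^sup>2 + (2 * e2 + e3)\<^sup>2) - 3 * P"
    and "C1 = (2 * e1 - e2) * (A1 - A2) - (2 * e2 + e3) * (A2 - A3) - (2 * e3 + e1) * (A3 - A1)"
    and "C2 = (2 * e1 - e2) * (A1 - A2) + (2 * e2 + e3) * (A2 - A3) + (2 * e3 + e1) * (A3 - A1)"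
    and "C3 = (2 * e1 - e2) * (A1 - A2) - (2 * e2 + e3) * (A2 - A3) + (2 * e3 + e1) * (A3 - A1)"
  \<comment> \<open>The first three relations in \<open>r\<close> form a nonsingular cyclic linear
    system for the \<open>A\<close>; the fourth minus their mean contains no \<open>A\<close> and no
    \<open>P\<close> and is the quadratic relation. The relations in \<open>c\<close> are a
    nonsingular linear system for the \<open>C\<close>.\<close>
  using r c by algebra+

text \<open>After the \<open>A\<close> are inserted, both sides are quadratic forms in the
  \<open>e\<close> plus \<open>14 * P\<close>, and the forms agree modulo \<open>Q\<close>.\<close>

lemma level_7_log_derivs:
  fixes e1 e2 e3 A1 A2 A3 P x y z :: complex
  assumes xyz: "x = e1 - e2 - 2 * e3" "y = 2 * e2 - e1 - e3" "z = 2 * e1 + e2 + e3"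
    and Q: "e1\<^sup>2 + e2\<^sup>2 + e3\<^sup>2 - 5 * e1 * e2 + 5 * e2 * e3 + 5 * e1 * e3 = 0"
    and A: "36 * A1 = 4 * (4 * (2 * e1 - e2)\<^sup>2 - 2 * (2 * e2 + e3)\<^sup>2 + (2 * e3 + e1)\<^sup>2) - 3 * P"
      "36 * A2 = 4 * (4 * (2 * e2 + e3)\<^sup>2 - 2 * (2 * e3 + e1)\<^sup>2 + (2 * e1 - e2)\<^sup>2) - 3 * P"
      "36 * A3 = 4 * (4 * (2 * e3 + e1)\<^sup>2 - 2 * (2 * e1 - e2)\<^sup>2 + (2 * e2 + e3)\<^sup>2) - 3 * P"
  shows "2 * (5 * y\<^sup>2 + 5 * z\<^sup>2 - 7 * x\<^sup>2 + 20 * y * z + 52 * x * y + 7 * P) =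
      84 * (2 * (A3 - e3\<^sup>2) - (A2 - e2\<^sup>2)) + 21 * P"
    and "2 * (5 * z\<^sup>2 + 5 * x\<^sup>2 - 7 * y\<^sup>2 + 20 * x * z + 52 * y * z + 7 * P) =
      84 * (2 * (A2 - e2\<^sup>2) - (A1 - e1\<^sup>2)) + 21 * P"
    and "2 * (5 * x\<^sup>2 + 5 * y\<^sup>2 - 7 * z\<^sup>2 + 20 * x * y + 52 * x * z + 7 * P) =
      84 * (2 * (A1 - e1\<^sup>2) - (A3 - e3\<^sup>2)) + 21 * P"
  unfolding xyz using Q A by algebra+

text \<open>The hypotheses \<open>d\<close> are the heat equation. Modulo \<open>Q\<close>, each of
  the three linear combinations divides its own derivative, and the cofactor is 24 times the
  logarithmic derivative of a theta quotient.\<close>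

lemma level_7_derivs:
  fixes e1 e2 e3 A1 A2 A3 C1 C2 C3 P x y z d1 d2 d3 :: complex
  assumes xyz: "x = e1 - e2 - 2 * e3" "y = 2 * e2 - e1 - e3" "z = 2 * e1 + e2 + e3"
    and Q: "e1\<^sup>2 + e2\<^sup>2 + e3\<^sup>2 - 5 * e1 * e2 + 5 * e2 * e3 + 5 * e1 * e3 = 0"
    and A: "36 * A1 = 4 * (4 * (2 * e1 - e2)\<^sup>2 - 2 * (2 * e2 + e3)\<^sup>2 + (2 * e3 + e1)\<^sup>2) - 3 * P"
      "36 * A2 = 4 * (4 * (2 * e2 + e3)\<^sup>2 - 2 * (2 * e3 + e1)\<^sup>2 + (2 * e1 - e2)\<^sup>2) - 3 * P"
      "36 * A3 = 4 * (4 * (2 * e3 + e1)\<^sup>2 - 2 * (2 * e1 - e2)\<^sup>2 + (2 * e2 + e3)\<^sup>2) - 3 * P"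
    and C: "C1 = (2 * e1 - e2) * (A1 - A2) - (2 * e2 + e3) * (A2 - A3) - (2 * e3 + e1) * (A3 - A1)"
      "C2 = (2 * e1 - e2) * (A1 - A2) + (2 * e2 + e3) * (A2 - A3) + (2 * e3 + e1) * (A3 - A1)"
      "C3 = (2 * e1 - e2) * (A1 - A2) - (2 * e2 + e3) * (A2 - A3) + (2 * e3 + e1) * (A3 - A1)"
    and d: "2 * d1 = 7 * (C1 - 2 * e1 * A1)" "2 * d2 = 7 * (C2 - 2 * e2 * A2)" "2 * d3 = 7 * (C3 - 2 * e3 * A3)"
  shows "24 * (d1 - d2 - 2 * d3) = x * (84 * (2 * (A3 - e3\<^sup>2) - (A2 - e2\<^sup>2)) + 21 * P)"
    and "24 * (2 * d2 - d1 - d3) = y * (84 * (2 * (A2 - e2\<^sup>2) - (A1 - e1\<^sup>2)) + 21 * P)"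
    and "24 * (2 * d1 + d2 + d3) = z * (84 * (2 * (A1 - e1\<^sup>2) - (A3 - e3\<^sup>2)) + 21 * P)"
  unfolding xyz using Q A C d by algebra+

text \<open>The addition formula for 1 + 2 = 3 gives P = 4 (e1 + e2 - e3)^2 - 4 (A1 + A2 + A3), and
  the left side is 12 times the derivative of this expression.\<close>

lemma level_7_deriv_P:
  fixes e1 e2 e3 A1 A2 A3 C1 C2 C3 F1 F2 F3 P x y z d1 d2 d3 a1 a2 a3 :: complex
  assumes xyz: "x = e1 - e2 - 2 * e3" "y = 2 * e2 - e1 - e3" "z = 2 * e1 + e2 + e3"
    and Q: "e1\<^sup>2 + e2\<^sup>2 + e3\<^sup>2 - 5 * e1 * e2 + 5 * e2 * e3 + 5 * e1 * e3 = 0"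
    and A: "36 * A1 = 4 * (4 * (2 * e1 - e2)\<^sup>2 - 2 * (2 * e2 + e3)\<^sup>2 + (2 * e3 + e1)\<^sup>2) - 3 * P"
      "36 * A2 = 4 * (4 * (2 * e2 + e3)\<^sup>2 - 2 * (2 * e3 + e1)\<^sup>2 + (2 * e1 - e2)\<^sup>2) - 3 * P"
      "36 * A3 = 4 * (4 * (2 * e3 + e1)\<^sup>2 - 2 * (2 * e1 - e2)\<^sup>2 + (2 * e2 + e3)\<^sup>2) - 3 * P"
    and C: "C1 = (2 * e1 - e2) * (A1 - A2) - (2 * e2 + e3) * (A2 - A3) - (2 * e3 + e1) * (A3 - A1)"
      "C2 = (2 * e1 - e2) * (A1 - A2) + (2 * e2 + e3) * (A2 - A3) + (2 * e3 + e1) * (A3 - A1)"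
      "C3 = (2 * e1 - e2) * (A1 - A2) - (2 * e2 + e3) * (A2 - A3) + (2 * e3 + e1) * (A3 - A1)"
    and d: "2 * d1 = 7 * (C1 - 2 * e1 * A1)" "2 * d2 = 7 * (C2 - 2 * e2 * A2)" "2 * d3 = 7 * (C3 - 2 * e3 * A3)"
    and F: "F1 = 2 * (A3 - A1)\<^sup>2 + 2 * (2 * e3 + e1) * C1"
      "F2 = 2 * (A1 - A2)\<^sup>2 - 2 * (2 * e1 - e2) * C2"
      "F3 = 2 * (A2 - A3)\<^sup>2 + 2 * (2 * e2 + e3) * C3"
    and a: "2 * a1 = 7 * (F1 - 2 * A1\<^sup>2 - 2 * e1 * C1)" "2 * a2 = 7 * (F2 - 2 * A2\<^sup>2 - 2 * e2 * C2)"
      "2 * a3 = 7 * (F3 - 2 * A3\<^sup>2 - 2 * e3 * C3)"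
  shows "12 * (8 * (e1 + e2 - e3) * (d1 + d2 - d3) - 4 * (a1 + a2 + a3)) =
    7 * (P\<^sup>2 - x ^ 4 - 4 * x ^ 3 * y - 12 * x * y ^ 3 - y ^ 4 - 12 * x ^ 3 * z
        - 4 * y ^ 3 * z - 4 * x * z ^ 3 - 12 * y * z ^ 3 - z ^ 4)"
proof -
  \<comment> \<open>This scaling clears all denominators; the cofactor of the quadratic relation below is found by polynomial division.\<close>
  define f1 f2 f3 p where "f1 = e1 / 3" and "f2 = e2 / 3" and "f3 = e3 / 3" and "p = P / 12"
  have f: "e1 = 3 * f1" "e2 = 3 * f2" "e3 = 3 * f3" "P = 12 * p"
    by (simp_all add: f1_def f2_def f3_def p_def)
  have A1: "A1 = 17 * f1\<^sup>2 - 16 * f1 * f2 + 4 * f1 * f3 - 4 * f2\<^sup>2 - 8 * f2 * f3 + 2 * f3\<^sup>2 - p"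
    and A2: "A2 = 2 * f1\<^sup>2 - 4 * f1 * f2 - 8 * f1 * f3 + 17 * f2\<^sup>2 + 16 * f2 * f3 - 4 * f3\<^sup>2 - p"
    and A3: "A3 = - 4 * f1\<^sup>2 + 8 * f1 * f2 + 16 * f1 * f3 + 2 * f2\<^sup>2 + 4 * f2 * f3 + 17 * f3\<^sup>2 - p"
    using A f by algebra+
  have "12 * (8 * (e1 + e2 - e3) * (d1 + d2 - d3) - 4 * (a1 + a2 + a3)) =
    12 * (4 * (e1 + e2 - e3) * (2 * d1 + 2 * d2 - 2 * d3) - 2 * (2 * a1 + 2 * a2 + 2 * a3))"
    by (simp add: algebra_simps)
  also have "\<dots> = 7 * (P\<^sup>2 - x ^ 4 - 4 * x ^ 3 * y - 12 * x * y ^ 3 - y ^ 4 - 12 * x ^ 3 * z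
        - 4 * y ^ 3 * z - 4 * x * z ^ 3 - 12 * y * z ^ 3 - z ^ 4) +
     (- 5810 * f1\<^sup>2 + 4858 * f1 * f2 - 4858 * f1 * f3 - 5810 * f2\<^sup>2 - 4858 * f2 * f3 - 5810 * f3\<^sup>2 - 448 * p) *
     (e1\<^sup>2 + e2\<^sup>2 + e3\<^sup>2 - 5 * e1 * e2 + 5 * e2 * e3 + 5 * e1 * e3)"
    unfolding d a F C A1 A2 A3 xyz f by algebra
  finally show ?thesis using Q by simp
qed

subsection \<open>Values at the 7-torsion points\<close>

text \<open>
  The shift makes \<open>zeta7 a\<close> odd under \<open>a \<mapsto> 7 - a\<close> and completes the square in the logarithmic derivative of \<open>theta7 a\<close>.
\<close>

definition zeta7 :: "nat \<Rightarrow> complex \<Rightarrow> complex" where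
  "zeta7 a q = zeta1 (q ^ 7) (q ^ a) - of_nat a / 7"

text \<open>For k = 1, 2, 3 these are \<open>\<wp>\<close> and its first two \<open>u d/du\<close>
  derivatives at u = q^a.\<close>

definition wp7 :: "nat \<Rightarrow> nat \<Rightarrow> complex \<Rightarrow> complex" where
  "wp7 k a q = lamS k (q ^ 7) (q ^ a)"

lemma norm_power_7_less:
  fixes q :: complex
  assumes "q \<noteq> 0" "norm q < 1" "a \<le> 6"
  shows "norm (q ^ 7) < norm (q ^ a)"
  unfolding norm_power using assms by (intro power_strict_decreasing) auto

text \<open>The shifts by a/7, b/7 and c/7 cancel because a + b = c; the bound c \<le> 6 keeps q^c
  in the annulus.\<close>

lemma zeta7_addition:
  assumes q: "q \<noteq> 0" "norm q < 1" and ab: "1 \<le> a" "1 \<le> b" "a + b = c" "c \<le> 6"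
  shows "4 * (zeta7 a q + zeta7 b q - zeta7 c q)\<^sup>2 = 4 * (wp7 1 a q + wp7 1 b q + wp7 1 c q) + P7 q"
    and "2 * (zeta7 a q + zeta7 b q - zeta7 c q) * (wp7 1 a q - wp7 1 c q) = wp7 2 a q + wp7 2 c q"
    and "2 * (wp7 1 b q - wp7 1 c q) * (wp7 1 a q - wp7 1 c q) -
      2 * (zeta7 a q + zeta7 b q - zeta7 c q) * wp7 2 c q = wp7 3 c q"
proof -
  have c: "q ^ a * q ^ b = q ^ c" using ab by (simp flip: power_add)
  have p: "q ^ 7 \<noteq> 0" "norm (q ^ 7) < norm (q ^ a * q ^ b)" "norm (q ^ a) < 1" "norm (q ^ b) < 1"
    unfolding c using q ab norm_power_7_less[OF q ab(4)] by (auto intro: norm_power_less_one)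
  have "of_nat c = (of_nat a + of_nat b :: complex)" using ab by auto
  then have z: "zeta7 a q + zeta7 b q - zeta7 c q = zeta1 (q ^ 7) (q ^ a) + zeta1 (q ^ 7) (q ^ b) - zeta1 (q ^ 7) (q ^ c)"
    by (simp add: zeta7_def field_simps)
  show "4 * (zeta7 a q + zeta7 b q - zeta7 c q)\<^sup>2 = 4 * (wp7 1 a q + wp7 1 b q + wp7 1 c q) + P7 q"
    "2 * (zeta7 a q + zeta7 b q - zeta7 c q) * (wp7 1 a q - wp7 1 c q) = wp7 2 a q + wp7 2 c q"
    "2 * (wp7 1 b q - wp7 1 c q) * (wp7 1 a q - wp7 1 c q) -
      2 * (zeta7 a q + zeta7 b q - zeta7 c q) * wp7 2 c q = wp7 3 c q"
    unfolding z wp7_def P7_eq[OF q(2)]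
    using zeta1_addition_square[OF p] zeta1_addition_deriv[OF p] zeta1_addition_deriv2[OF p] unfolding c by simp_all
qed

lemma wp7_reflect:
  assumes "q \<noteq> 0" "a \<le> 7" "b = 7 - a"
  shows "wp7 k b q = - ((-1) ^ k * wp7 k a q)"
proof -
  have "q ^ b = q ^ 7 / q ^ a" using assms by (simp add: power_diff)
  then show ?thesis using lamS_reflect[of "q ^ 7" "q ^ a" k] assms by (simp add: wp7_def)
qed

lemma zeta7_reflect:
  assumes "q \<noteq> 0" "a \<le> 7" "b = 7 - a"
  shows "zeta7 b q = - zeta7 a q"
proof -
  have c: "of_nat b = (7 - of_nat a :: complex)" using assms by simp
  have s: "lamS 0 (q ^ 7) (q ^ b) = - lamS 0 (q ^ 7) (q ^ a)"
    using wp7_reflect[OF assms, of 0] by (simp add: wp7_def)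
  show ?thesis unfolding zeta7_def zeta1_def c s by (simp add: field_simps)
qed

text \<open>The shift by -a/7 absorbs the \<open>u d/du\<close> part of \<open>q d/dq\<close> into
  the product term of the heat equation.\<close>

lemma has_qderiv_zeta7:
  assumes q: "q \<noteq> 0" "norm q < 1" and a: "1 \<le> a" "a \<le> 6"
  shows "has_qderiv (zeta7 a) (7 * (wp7 2 a q / 2 - zeta7 a q * wp7 1 a q)) q"
proof -
  have p: "q ^ 7 \<noteq> 0" "norm (q ^ 7) < norm (q ^ a)" "norm (q ^ a) < 1"
    using q a by (auto intro: norm_power_7_less norm_power_less_one)
  have "has_qderiv (\<lambda>q. 1 / 2 + lamS 0 (q ^ 7) (q ^ a) - of_nat a / 7)
     (0 + (of_nat a * lamS (Suc 0) (q ^ 7) (q ^ a) + 7 * lamH (Suc 0) (q ^ 7) (q ^ a)) - 0) q"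
    by (intro has_qderiv_diff has_qderiv_add has_qderiv_const has_qderiv_lamS q a)
  moreover have "of_nat a * lamS (Suc 0) (q ^ 7) (q ^ a) + 7 * lamH (Suc 0) (q ^ 7) (q ^ a) =
     7 * (wp7 2 a q / 2 - zeta7 a q * wp7 1 a q)"
  proof -
    have h: "lamH (Suc 0) (q ^ 7) (q ^ a) = lamS 2 (q ^ 7) (q ^ a) / 2 - zeta1 (q ^ 7) (q ^ a) * lamS (Suc 0) (q ^ 7) (q ^ a)"
      using lamH_1_eq[OF p] by (simp add: field_simps)
    show ?thesis unfolding h by (simp add: wp7_def zeta7_def field_simps)
  qed
  ultimately show ?thesis by (simp add: zeta7_def[abs_def] zeta1_def)
qed

lemma has_qderiv_wp7_1:
  assumes q: "q \<noteq> 0" "norm q < 1" and a: "1 \<le> a" "a \<le> 6"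
  shows "has_qderiv (wp7 1 a) (7 * (wp7 3 a q / 2 - (wp7 1 a q)\<^sup>2 - zeta7 a q * wp7 2 a q)) q"
proof -
  have p: "q ^ 7 \<noteq> 0" "norm (q ^ 7) < norm (q ^ a)" "norm (q ^ a) < 1"
    using q a by (auto intro: norm_power_7_less norm_power_less_one)
  have "has_qderiv (\<lambda>q. lamS 1 (q ^ 7) (q ^ a))
     (of_nat a * lamS (Suc 1) (q ^ 7) (q ^ a) + 7 * lamH (Suc 1) (q ^ 7) (q ^ a)) q"
    by (intro has_qderiv_lamS q a)
  moreover have "of_nat a * lamS 2 (q ^ 7) (q ^ a) + 7 * lamH 2 (q ^ 7) (q ^ a) =
     7 * (wp7 3 a q / 2 - (wp7 1 a q)\<^sup>2 - zeta7 a q * wp7 2 a q)"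
  proof -
    have h: "lamH 2 (q ^ 7) (q ^ a) = lamS 3 (q ^ 7) (q ^ a) / 2 - zeta1 (q ^ 7) (q ^ a) * lamS 2 (q ^ 7) (q ^ a) - (lamS 1 (q ^ 7) (q ^ a))\<^sup>2"
      using lamH_2_eq[OF p] by (simp add: field_simps)
    show ?thesis unfolding h by (simp add: wp7_def zeta7_def field_simps)
  qed
  ultimately show ?thesis by (simp add: wp7_def[abs_def] flip: numeral_2_eq_2)
qed

definition thetal :: "nat \<Rightarrow> nat \<Rightarrow> complex \<Rightarrow> complex" where
  "thetal a b q = (84 * (2 * (wp7 1 b q - (zeta7 b q)\<^sup>2) - (wp7 1 a q - (zeta7 a q)\<^sup>2)) + 21 * P7 q) / 24"

text \<open>The constant is -1, -1, 0 for (a,b) = (2,3), (1,2), (3,1). The prefactors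
  \<open>q\<close>, \<open>- q\<close>, \<open>1\<close> compensate it, so \<open>thetal\<close> is
  the logarithmic derivative of \<open>x7\<close>, \<open>y7\<close>, \<open>z7\<close>
  itself.\<close>

lemma thetaq_log_deriv:
  assumes q: "q \<noteq> 0" "norm q < 1" and ab: "1 \<le> a" "a \<le> 6" "1 \<le> b" "b \<le> 6"
  shows "2 * (of_nat b * lamS 0 (q ^ 7) (q ^ b) + 7 * lamH 0 (q ^ 7) (q ^ b))
      - (of_nat a * lamS 0 (q ^ 7) (q ^ a) + 7 * lamH 0 (q ^ 7) (q ^ a)) - 14 * lam2 (\<lambda>_. 1) (q ^ 7) 1
     = thetal a b q + (2 * (of_nat b)\<^sup>2 - (of_nat a)\<^sup>2) / 14 - (2 * of_nat b - of_nat a) / 2"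
proof -
  \<comment> \<open>Substituting \<open>zeta7\<close> plus a/7 for \<open>zeta1\<close> cancels the
    terms in a times \<open>zeta7\<close>.\<close>
  have *: "24 * (of_nat a * lamS 0 (q ^ 7) (q ^ a) + 7 * lamH 0 (q ^ 7) (q ^ a)) =
     84 * (wp7 1 a q - (zeta7 a q)\<^sup>2) + 7 * P7 q + 12 / 7 * (of_nat a)\<^sup>2 - 12 * of_nat a + 14"
    if "1 \<le> a" "a \<le> 6" for a
  proof -
    have p: "q ^ 7 \<noteq> 0" "norm (q ^ 7) < norm (q ^ a)" "norm (q ^ a) < 1"
      using q that by (auto intro: norm_power_7_less norm_power_less_one)
    have h: "7 * (24 * lamH 0 (q ^ 7) (q ^ a)) = 7 * (12 * wp7 1 a q - 12 * (zeta7 a q + of_nat a / 7)\<^sup>2 + 2 + P7 q)"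
      unfolding lamH_0_eq[OF p] by (simp add: wp7_def zeta7_def P7_eq[OF q(2)])
    have s: "lamS 0 (q ^ 7) (q ^ a) = zeta7 a q + of_nat a / 7 - 1 / 2"
      by (simp add: zeta7_def zeta1_def)
    have eq: "24 * (of_nat a * lamS 0 (q ^ 7) (q ^ a) + 7 * lamH 0 (q ^ 7) (q ^ a)) =
       24 * of_nat a * lamS 0 (q ^ 7) (q ^ a) + 7 * (24 * lamH 0 (q ^ 7) (q ^ a))" by (simp add: algebra_simps)
    show ?thesis unfolding eq unfolding h s by (simp add: field_simps power2_eq_square)
  qed
  have e: "24 * lam2 (\<lambda>_. 1) (q ^ 7) 1 = 1 - P7 q" using P7_eq[OF q(2)] by (simp add: eisP_def)
  have "24 * (2 * (of_nat b * lamS 0 (q ^ 7) (q ^ b) + 7 * lamH 0 (q ^ 7) (q ^ b))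
      - (of_nat a * lamS 0 (q ^ 7) (q ^ a) + 7 * lamH 0 (q ^ 7) (q ^ a)) - 14 * lam2 (\<lambda>_. 1) (q ^ 7) 1) =
    2 * (24 * (of_nat b * lamS 0 (q ^ 7) (q ^ b) + 7 * lamH 0 (q ^ 7) (q ^ b)))
      - 24 * (of_nat a * lamS 0 (q ^ 7) (q ^ a) + 7 * lamH 0 (q ^ 7) (q ^ a)) - 14 * (24 * lam2 (\<lambda>_. 1) (q ^ 7) 1)"
    by (simp add: algebra_simps)
  also have "\<dots> = 24 * (thetal a b q + (2 * (of_nat b)\<^sup>2 - (of_nat a)\<^sup>2) / 14 - (2 * of_nat b - of_nat a) / 2)"
    unfolding *[OF ab(1,2)] *[OF ab(3,4)] e thetal_def by (simp add: field_simps)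
  finally show ?thesis by (rule mult_left_cancel[THEN iffD1, rotated]) simp
qed

lemma x7_eq: "x7 q = q * thetaq 2 3 q"
  and y7_eq: "y7 q = - (q * thetaq 1 2 q)"
  and z7_eq: "z7 q = thetaq 3 1 q"
  by (simp_all add: x7_def y7_def z7_def qpochs_def thetaq_def theta7_def power2_eq_square mult_ac)

lemma has_qderiv_xyz7:
  assumes q: "q \<noteq> 0" "norm q < 1"
  shows "has_qderiv x7 (x7 q * thetal 2 3 q) q" "has_qderiv y7 (y7 q * thetal 1 2 q) q"
    "has_qderiv z7 (z7 q * thetal 3 1 q) q"
proof -
  have t: "has_qderiv (thetaq a b) (thetaq a b q *
     (thetal a b q + (2 * (of_nat b)\<^sup>2 - (of_nat a)\<^sup>2) / 14 - (2 * of_nat b - of_nat a) / 2)) q"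
    if "1 \<le> a" "a \<le> 6" "1 \<le> b" "b \<le> 6" for a b
    using has_qderiv_thetaq[OF q(2) that] unfolding thetaq_log_deriv[OF q that] .
  show "has_qderiv x7 (x7 q * thetal 2 3 q) q"
    using has_qderiv_mult[OF has_qderiv_ident t[of 2 3]] by (simp add: x7_eq[abs_def] algebra_simps)
  show "has_qderiv y7 (y7 q * thetal 1 2 q) q"
    using has_qderiv_cmult[OF has_qderiv_mult[OF has_qderiv_ident t[of 1 2]], of "-1"]
    by (simp add: y7_eq[abs_def] algebra_simps)
  show "has_qderiv z7 (z7 q * thetal 3 1 q) q"
    using t[of 3 1] by (simp add: z7_eq[abs_def])
qed

lemma level_7_system:
  assumes q: "q \<noteq> 0" "norm q < 1"
  defines "x \<equiv> zeta7 1 q - zeta7 2 q - 2 * zeta7 3 q"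
    and "y \<equiv> 2 * zeta7 2 q - zeta7 1 q - zeta7 3 q"
    and "z \<equiv> 2 * zeta7 1 q + zeta7 2 q + zeta7 3 q"
  shows "thetal 2 3 q = (5 * y\<^sup>2 + 5 * z\<^sup>2 - 7 * x\<^sup>2 + 20 * y * z + 52 * x * y + 7 * P7 q) / 12"
    and "thetal 1 2 q = (5 * z\<^sup>2 + 5 * x\<^sup>2 - 7 * y\<^sup>2 + 20 * x * z + 52 * y * z + 7 * P7 q) / 12"
    and "thetal 3 1 q = (5 * x\<^sup>2 + 5 * y\<^sup>2 - 7 * z\<^sup>2 + 20 * x * y + 52 * x * z + 7 * P7 q) / 12"
    and "has_qderiv (\<lambda>q. zeta7 1 q - zeta7 2 q - 2 * zeta7 3 q) (x * thetal 2 3 q) q"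
    and "has_qderiv (\<lambda>q. 2 * zeta7 2 q - zeta7 1 q - zeta7 3 q) (y * thetal 1 2 q) q"
    and "has_qderiv (\<lambda>q. 2 * zeta7 1 q + zeta7 2 q + zeta7 3 q) (z * thetal 3 1 q) q"
    and "has_qderiv P7 (7 / 12 * ((P7 q)\<^sup>2 - x ^ 4 - 4 * x ^ 3 * y - 12 * x * y ^ 3 - y ^ 4 - 12 * x ^ 3 * z
        - 4 * y ^ 3 * z - 4 * x * z ^ 3 - 12 * y * z ^ 3 - z ^ 4)) q"
proof -
  define e1 e2 e3 where e: "e1 = zeta7 1 q" "e2 = zeta7 2 q" "e3 = zeta7 3 q"
  define A1 A2 A3 where A: "A1 = wp7 1 1 q" "A2 = wp7 1 2 q" "A3 = wp7 1 3 q"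
  define C1 C2 C3 where C: "C1 = wp7 2 1 q" "C2 = wp7 2 2 q" "C3 = wp7 2 3 q"
  define F1 F2 F3 where F: "F1 = wp7 3 1 q" "F2 = wp7 3 2 q" "F3 = wp7 3 3 q"
  define P where P: "P = P7 q"
  note defs = e A C F P
  have z: "zeta7 4 q = - zeta7 3 q" "zeta7 6 q = - zeta7 1 q"
    by (rule zeta7_reflect[OF q(1)]; simp)+
  have w: "wp7 k 4 q = - ((-1) ^ k * wp7 k 3 q)" "wp7 k 6 q = - ((-1) ^ k * wp7 k 1 q)" for k
    by (rule wp7_reflect[OF q(1)]; simp)+
  have w': "wp7 1 4 q = wp7 1 3 q" "wp7 1 6 q = wp7 1 1 q" "wp7 2 4 q = - wp7 2 3 q" "wp7 2 6 q = - wp7 2 1 q"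
      "wp7 3 4 q = wp7 3 3 q" "wp7 3 6 q = wp7 3 1 q"
    unfolding w by simp_all
  have n: "1 \<le> (1::nat)" "1 \<le> (2::nat)" "1 \<le> (3::nat)" by simp_all
  have n': "1 + 1 = (2::nat)" "2 \<le> (6::nat)" "2 + 2 = (4::nat)" "4 \<le> (6::nat)" "3 + 3 = (6::nat)" "6 \<le> (6::nat)"
      "1 + 2 = (3::nat)" "3 \<le> (6::nat)" by simp_all
  \<comment> \<open>The doublings of 1, 2, 3 and the sum 1 + 2 = 3 close up, because reflection
    sends the indices 4 and 6 to 3 and 1.\<close>
  note add_112 = zeta7_addition[OF q n(1,1) n'(1,2), unfolded z w', folded defs]
    and add_224 = zeta7_addition[OF q n(2,2) n'(3,4), unfolded z w', folded defs]
    and add_336 = zeta7_addition[OF q n(3,3) n'(5,6), unfolded z w', folded defs]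
    and add_123 = zeta7_addition[OF q n(1,2) n'(7,8), folded defs]
  have r: "4 * (2 * e1 - e2)\<^sup>2 = 4 * (2 * A1 + A2) + P"
    and c1: "2 * (2 * e1 - e2) * (A1 - A2) = C1 + C2"
    and F2: "F2 = 2 * (A1 - A2)\<^sup>2 - 2 * (2 * e1 - e2) * C2"
    using add_112 by algebra+
  have r2: "4 * (2 * e2 + e3)\<^sup>2 = 4 * (2 * A2 + A3) + P"
    and c2: "2 * (2 * e2 + e3) * (A2 - A3) = C2 - C3"
    and F3: "F3 = 2 * (A2 - A3)\<^sup>2 + 2 * (2 * e2 + e3) * C3"
    using add_224 by algebra+
  have r3: "4 * (2 * e3 + e1)\<^sup>2 = 4 * (2 * A3 + A1) + P"
    and c3: "2 * (2 * e3 + e1) * (A3 - A1) = C3 - C1"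
    and F1: "F1 = 2 * (A3 - A1)\<^sup>2 + 2 * (2 * e3 + e1) * C1"
    using add_336 by algebra+
  note el = level_7_elimination[OF r r2 r3 add_123(1) c1 c2 c3]
  define d1 d2 d3 where d: "d1 = 7 * (C1 / 2 - e1 * A1)" "d2 = 7 * (C2 / 2 - e2 * A2)" "d3 = 7 * (C3 / 2 - e3 * A3)"
  define a1 a2 a3 where a: "a1 = 7 * (F1 / 2 - A1\<^sup>2 - e1 * C1)" "a2 = 7 * (F2 / 2 - A2\<^sup>2 - e2 * C2)"
      "a3 = 7 * (F3 / 2 - A3\<^sup>2 - e3 * C3)"
  have d': "2 * d1 = 7 * (C1 - 2 * e1 * A1)" "2 * d2 = 7 * (C2 - 2 * e2 * A2)" "2 * d3 = 7 * (C3 - 2 * e3 * A3)"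
    and a': "2 * a1 = 7 * (F1 - 2 * A1\<^sup>2 - 2 * e1 * C1)" "2 * a2 = 7 * (F2 - 2 * A2\<^sup>2 - 2 * e2 * C2)"
      "2 * a3 = 7 * (F3 - 2 * A3\<^sup>2 - 2 * e3 * C3)"
    by (simp_all add: d a algebra_simps)
  have qe: "has_qderiv (zeta7 1) d1 q" "has_qderiv (zeta7 2) d2 q" "has_qderiv (zeta7 3) d3 q"
    using has_qderiv_zeta7[OF q, of 1] has_qderiv_zeta7[OF q, of 2] has_qderiv_zeta7[OF q, of 3]
    by (simp_all add: d defs)
  have qA: "has_qderiv (wp7 1 1) a1 q" "has_qderiv (wp7 1 2) a2 q" "has_qderiv (wp7 1 3) a3 q"
    using has_qderiv_wp7_1[OF q, of 1] has_qderiv_wp7_1[OF q, of 2] has_qderiv_wp7_1[OF q, of 3]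
    by (simp_all add: a defs)
  have xyz: "x = e1 - e2 - 2 * e3" "y = 2 * e2 - e1 - e3" "z = 2 * e1 + e2 + e3"
    by (simp_all add: x_def y_def z_def defs)
  have l: "24 * thetal 2 3 q = 84 * (2 * (A3 - e3\<^sup>2) - (A2 - e2\<^sup>2)) + 21 * P"
     "24 * thetal 1 2 q = 84 * (2 * (A2 - e2\<^sup>2) - (A1 - e1\<^sup>2)) + 21 * P"
     "24 * thetal 3 1 q = 84 * (2 * (A1 - e1\<^sup>2) - (A3 - e3\<^sup>2)) + 21 * P"
    by (simp_all add: thetal_def defs)
  have cancel: "u = v * w" if "24 * u = v * (24 * w)" for u v w :: complex
    using that by algebra
  have halve: "u = v / 12" if "2 * v = 24 * u" for u v :: complex
  proof -
    have "v = 12 * u" using that by algebra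
    then show ?thesis by simp
  qed
  note ld = level_7_log_derivs[OF xyz el(1-4), folded l]
  show "thetal 2 3 q = (5 * y\<^sup>2 + 5 * z\<^sup>2 - 7 * x\<^sup>2 + 20 * y * z + 52 * x * y + 7 * P7 q) / 12"
    "thetal 1 2 q = (5 * z\<^sup>2 + 5 * x\<^sup>2 - 7 * y\<^sup>2 + 20 * x * z + 52 * y * z + 7 * P7 q) / 12"
    "thetal 3 1 q = (5 * x\<^sup>2 + 5 * y\<^sup>2 - 7 * z\<^sup>2 + 20 * x * y + 52 * x * z + 7 * P7 q) / 12"
    unfolding P[symmetric] by (rule halve[OF ld(1)] halve[OF ld(2)] halve[OF ld(3)])+
  note ds = level_7_derivs[OF xyz el d', folded l]
  have "d1 - d2 - 2 * d3 = x * thetal 2 3 q" "2 * d2 - d1 - d3 = y * thetal 1 2 q" "2 * d1 + d2 + d3 = z * thetal 3 1 q"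
    by (rule cancel[OF ds(1)] cancel[OF ds(2)] cancel[OF ds(3)])+
  then show "has_qderiv (\<lambda>q. zeta7 1 q - zeta7 2 q - 2 * zeta7 3 q) (x * thetal 2 3 q) q"
    "has_qderiv (\<lambda>q. 2 * zeta7 2 q - zeta7 1 q - zeta7 3 q) (y * thetal 1 2 q) q"
    "has_qderiv (\<lambda>q. 2 * zeta7 1 q + zeta7 2 q + zeta7 3 q) (z * thetal 3 1 q) q"
    using has_qderiv_diff[OF has_qderiv_diff[OF qe(1,2)] has_qderiv_cmult[OF qe(3), of 2]]
      has_qderiv_diff[OF has_qderiv_diff[OF has_qderiv_cmult[OF qe(2), of 2] qe(1)] qe(3)]
      has_qderiv_add[OF has_qderiv_add[OF has_qderiv_cmult[OF qe(1), of 2] qe(2)] qe(3)]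
    by simp_all
  \<comment> \<open>Near q, \<open>P7\<close> equals \<open>4 * f\<^sup>2\<close> minus 4 times the
    sum of the three values of \<open>wp7 1\<close>, so it is differentiated through this
    expression.\<close>
  define f where "f = (\<lambda>q. zeta7 1 q + zeta7 2 q - zeta7 3 q)"
  have f: "has_qderiv f (d1 + d2 - d3) q" unfolding f_def
    by (intro has_qderiv_add has_qderiv_diff qe)
  have fq: "f q = e1 + e2 - e3" by (simp add: f_def defs)
  have "has_qderiv (\<lambda>q. 4 * (f q * f q) - 4 * (wp7 1 1 q + wp7 1 2 q + wp7 1 3 q))
    (4 * ((d1 + d2 - d3) * f q + f q * (d1 + d2 - d3)) - 4 * (a1 + a2 + a3)) q"
    by (intro has_qderiv_add has_qderiv_diff has_qderiv_cmult has_qderiv_mult f qA)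
  also have "(4 * ((d1 + d2 - d3) * f q + f q * (d1 + d2 - d3)) - 4 * (a1 + a2 + a3)) =
    (12 * (8 * (e1 + e2 - e3) * (d1 + d2 - d3) - 4 * (a1 + a2 + a3))) / 12"
    unfolding fq by (simp add: algebra_simps)
  also have "\<dots> = 7 / 12 * (P\<^sup>2 - x ^ 4 - 4 * x ^ 3 * y - 12 * x * y ^ 3 - y ^ 4 - 12 * x ^ 3 * z
        - 4 * y ^ 3 * z - 4 * x * z ^ 3 - 12 * y * z ^ 3 - z ^ 4)"
    unfolding level_7_deriv_P[OF xyz el d' F1 F2 F3 a'] by simp
  finally show "has_qderiv P7 (7 / 12 * ((P7 q)\<^sup>2 - x ^ 4 - 4 * x ^ 3 * y - 12 * x * y ^ 3 - y ^ 4 - 12 * x ^ 3 * z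
        - 4 * y ^ 3 * z - 4 * x * z ^ 3 - 12 * y * z ^ 3 - z ^ 4)) q"
    unfolding P
  proof (rule has_qderiv_cong_ev[where S = "ball 0 1 - {0}"])
    fix t :: complex assume "t \<in> ball 0 1 - {0}"
    then have t: "t \<noteq> 0" "norm t < 1" by auto
    show "4 * (f t * f t) - 4 * (wp7 1 1 t + wp7 1 2 t + wp7 1 3 t) = P7 t"
      using zeta7_addition(1)[OF t, of 1 2 3] by (simp add: f_def power2_eq_square)
  qed (use q in auto)
qed

section \<open>Leading terms at q = 0 and identification of x, y, z\<close>

lemma lam_0_0 [simp]: "lam w 0 0 = 0"
proof -
  have "w n * 0 ^ n / (1 - 0 ^ n) = 0" for n by (cases n) auto
  then show ?thesis unfolding lam_def by (simp only: suminf_zero)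
qed

lemma thetaq_0:
  assumes "1 \<le> a" "a \<le> 6" "1 \<le> b" "b \<le> 6"
  shows "thetaq a b 0 = 1"
proof -
  have "qpoch 0 0 = 1" by (simp add: qpoch_eq_exp)
  then show ?thesis using assms by (simp add: thetaq_def theta7_def power_0_left)
qed

lemma thetaq_tendsto:
  assumes "1 \<le> a" "a \<le> 6" "1 \<le> b" "b \<le> 6"
  shows "(thetaq a b \<longlongrightarrow> 1) (at 0)"
proof -
  have "isCont (thetaq a b) 0"
    using has_qderiv_thetaq[of 0 a b] assms DERIV_isCont by (auto simp: has_qderiv_def)
  then show ?thesis using thetaq_0[OF assms] by (simp add: isCont_def)
qed

lemma zeta7_eq:
  assumes "1 \<le> a" "a \<le> 6"
  shows "zeta7 a q = 1 / 2 - of_nat a / 7 + (lam (\<lambda>_. 1) (q ^ 7) (q ^ a) - lam (\<lambda>_. 1) (q ^ 7) (q ^ (7 - a)))"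
  using lamS_power[OF assms, of 0] by (simp add: zeta7_def zeta1_def)

text \<open>Among the terms q^(bn) / (1 - q^(7n)) with b = a or b = 7 - a, only b = n = 1
  contributes to first order at 0.\<close>

lemma zeta7_at_0:
  assumes "1 \<le> a" "a \<le> 6"
  shows "zeta7 a 0 = 1 / 2 - of_nat a / 7"
    and "(zeta7 a has_field_derivative (of_bool (a = 1) - of_bool (a = 6))) (at 0)"
proof -
  show "zeta7 a 0 = 1 / 2 - of_nat a / 7" using zeta7_eq[OF assms, of 0] assms by (simp add: power_0_left)
  have "dlam_term (\<lambda>_. 1) b n 0 = (if n = 1 then of_bool (b = 1) else 0)" if "b \<ge> 1" for b n
  proof (cases "n = 0")
    case False
    then have "b * n \<ge> 1" using that by simp
    then have "b * n - 1 = 0 \<longleftrightarrow> b = 1 \<and> n = 1" by (metis diff_is_0_eq le_antisym nat_mult_eq_1_iff order_refl)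
    then show ?thesis using False that by (auto simp: dlam_term_def power_0_left)
  qed (simp add: dlam_term_def)
  note dl = this
  have s: "(\<Sum>n. dlam_term (\<lambda>_. 1) b n 0) = of_bool (b = 1)" if "b \<ge> 1" for b
    unfolding dl[OF that] by (rule sums_unique[OF sums_single[of 1 "\<lambda>_. of_bool (b = 1)"], symmetric])
  have l: "((\<lambda>q. lam (\<lambda>_. 1) (q ^ 7) (q ^ b)) has_field_derivative of_bool (b = 1)) (at 0)" if "b \<ge> 1" for b
    using has_field_derivative_lam(1)[OF subexp_one _ that, of 0] s[OF that] by simp
  have "((\<lambda>q. 1 / 2 - of_nat a / 7 + (lam (\<lambda>_. 1) (q ^ 7) (q ^ a) - lam (\<lambda>_. 1) (q ^ 7) (q ^ (7 - a))))
     has_field_derivative (0 + (of_bool (a = 1) - of_bool (7 - a = 1)))) (at 0)"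
    using assms by (intro DERIV_add DERIV_const DERIV_diff l) auto
  moreover have "7 - a = 1 \<longleftrightarrow> a = 6" using assms by auto
  ultimately show "(zeta7 a has_field_derivative (of_bool (a = 1) - of_bool (a = 6))) (at 0)"
    unfolding zeta7_eq[OF assms, abs_def] by simp
qed

lemma tendsto_quotient_at_0:
  fixes f :: "complex \<Rightarrow> complex"
  assumes "(f has_field_derivative D) (at 0)" "f 0 = 0" "(g \<longlongrightarrow> 1) (at 0)"
  shows "((\<lambda>q. f q / (q * g q)) \<longlongrightarrow> D) (at 0)"
proof -
  have "((\<lambda>q. f q / q) \<longlongrightarrow> D) (at 0)"
    using assms(1,2) by (simp add: has_field_derivative_iff)
  from tendsto_divide[OF this assms(3)] show ?thesis by simp
qed

text \<open>Both sides have the logarithmic derivative \<open>thetal\<close>, and the zeta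
  combinations start with q, -q and 1 at q = 0, just like the theta quotients.\<close>

lemma xyz7_eq:
  assumes q: "q \<noteq> 0" "norm q < 1"
  shows "x7 q = zeta7 1 q - zeta7 2 q - 2 * zeta7 3 q" (is "_ = ?X q")
    and "y7 q = 2 * zeta7 2 q - zeta7 1 q - zeta7 3 q" (is "_ = ?Y q")
    and "z7 q = 2 * zeta7 1 q + zeta7 2 q + zeta7 3 q" (is "_ = ?Z q")
proof -
  have nz: "x7 q \<noteq> 0" "y7 q \<noteq> 0" "z7 q \<noteq> 0" if "q \<noteq> 0" "norm q < 1" for q
    using that by (simp_all add: x7_eq y7_eq z7_eq thetaq_nonzero)
  have d: "(zeta7 1 has_field_derivative 1) (at 0)" "(zeta7 2 has_field_derivative 0) (at 0)"
    "(zeta7 3 has_field_derivative 0) (at 0)"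
    using zeta7_at_0(2)[of 1] zeta7_at_0(2)[of 2] zeta7_at_0(2)[of 3] by simp_all
  have v: "zeta7 1 0 = 5 / 14" "zeta7 2 0 = 3 / 14" "zeta7 3 0 = 1 / 14"
    using zeta7_at_0(1)[of 1] zeta7_at_0(1)[of 2] zeta7_at_0(1)[of 3] by simp_all
  have X: "(?X has_field_derivative 1) (at 0)"
    using DERIV_diff[OF DERIV_diff[OF d(1,2)] DERIV_cmult[OF d(3), of 2]] by simp
  have Y: "(?Y has_field_derivative - 1) (at 0)"
    using DERIV_diff[OF DERIV_diff[OF DERIV_cmult[OF d(2), of 2] d(1)] d(3)] by simp
  have Z: "(?Z has_field_derivative 2) (at 0)"
    using DERIV_add[OF DERIV_add[OF DERIV_cmult[OF d(1), of 2] d(2)] d(3)] by simp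
  have v': "?X 0 = 0" "?Y 0 = 0" "?Z 0 = 1" unfolding v by simp_all
  have "((\<lambda>q. ?X q / x7 q) \<longlongrightarrow> 1) (at 0)"
    unfolding x7_eq by (rule tendsto_quotient_at_0[OF X v'(1)]) (simp add: thetaq_tendsto)
  then have "?X q = x7 q"
    using q by (intro eq_of_log_qderiv[where f = ?X, OF level_7_system(4) has_qderiv_xyz7(1) nz(1)])
  then show "x7 q = ?X q" by simp
  have "((\<lambda>q. - (?Y q / (q * thetaq 1 2 q))) \<longlongrightarrow> - (- 1)) (at 0)"
    by (rule tendsto_minus, rule tendsto_quotient_at_0[OF Y v'(2)]) (simp add: thetaq_tendsto)
  then have "((\<lambda>q. ?Y q / y7 q) \<longlongrightarrow> 1) (at 0)"
    by (simp add: y7_eq)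
  then have "?Y q = y7 q"
    using q by (intro eq_of_log_qderiv[where f = ?Y, OF level_7_system(5) has_qderiv_xyz7(2) nz(2)])
  then show "y7 q = ?Y q" by simp
  have "(?Z \<longlongrightarrow> ?Z 0) (at 0)" using DERIV_isCont[OF Z] by (simp only: isCont_def)
  then have "(?Z \<longlongrightarrow> 1) (at 0)" unfolding v'(3) .
  from tendsto_divide[OF this thetaq_tendsto[of 3 1]]
  have "((\<lambda>q. ?Z q / z7 q) \<longlongrightarrow> 1) (at 0)" by (simp add: z7_eq)
  then have "?Z q = z7 q"
    using q by (intro eq_of_log_qderiv[where f = ?Z, OF level_7_system(6) has_qderiv_xyz7(3) nz(3)])
  then show "z7 q = ?Z q" by simp
qed

section \<open>The differential system on the whole unit disc\<close>

lemma has_qderiv_at_0: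
  assumes "has_qderiv f d 0"
  shows "has_qderiv f 0 0"
  using assms by (auto simp: has_qderiv_def)

text \<open>Needed at q = 0, which \<open>level_7_system\<close> excludes.\<close>

lemma has_qderiv_P7:
  assumes q: "norm q < 1"
  shows "\<exists>d. has_qderiv P7 d q"
proof -
  have eq: "P7 t = 1 - 24 * lam of_nat (t ^ 7) (t ^ 7)" if "norm t < 1" for t
    using P7_eq[OF that] lam_id_eq_lam2[OF norm_power_less_one[OF that, of 7]] by (simp add: eisP_def)
  have "subexp of_nat" using subexp_power[of 1] by simp
  from has_qderiv_diff[OF has_qderiv_const[of 1] has_qderiv_cmult[OF has_qderiv_lam[OF this q, of 7], of 24]]
  obtain d where "has_qderiv (\<lambda>q. 1 - 24 * lam of_nat (q ^ 7) (q ^ 7)) d q" by auto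
  then have "has_qderiv P7 d q"
    by (rule has_qderiv_cong_ev[where S = "ball 0 1"]) (use q eq in auto)
  then show ?thesis ..
qed

theorem theorem1p4:
  fixes q :: complex
  assumes "norm q < 1"
  shows "x7 field_differentiable at q \<and> y7 field_differentiable at q \<and>
    z7 field_differentiable at q \<and> P7 field_differentiable at q \<and>
    (let x = x7 q; y = y7 q; z = z7 q; P = P7 q in
      q * deriv x7 q = x / 12 * (5 * y^2 + 5 * z^2 - 7 * x^2 + 20 * y * z + 52 * x * y + 7 * P) \<and>
      q * deriv y7 q = y / 12 * (5 * z^2 + 5 * x^2 - 7 * y^2 + 20 * x * z + 52 * y * z + 7 * P) \<and>
      q * deriv z7 q = z / 12 * (5 * x^2 + 5 * y^2 - 7 * z^2 + 20 * x * y + 52 * x * z + 7 * P) \<and>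
      q * deriv P7 q = 7 / 12 * (P^2 - x^4 - 4 * x^3 * y - 12 * x * y^3 - y^4 - 12 * x^3 * z
        - 4 * y^3 * z - 4 * x * z^3 - 12 * y * z^3 - z^4))"
proof -
  define x y z P where xyz: "x = x7 q" "y = y7 q" "z = z7 q" "P = P7 q"
  have "has_qderiv x7 (x / 12 * (5 * y^2 + 5 * z^2 - 7 * x^2 + 20 * y * z + 52 * x * y + 7 * P)) q \<and>
    has_qderiv y7 (y / 12 * (5 * z^2 + 5 * x^2 - 7 * y^2 + 20 * x * z + 52 * y * z + 7 * P)) q \<and>
    has_qderiv z7 (z / 12 * (5 * x^2 + 5 * y^2 - 7 * z^2 + 20 * x * y + 52 * x * z + 7 * P)) q \<and>
    has_qderiv P7 (7 / 12 * (P^2 - x^4 - 4 * x^3 * y - 12 * x * y^3 - y^4 - 12 * x^3 * z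
        - 4 * y^3 * z - 4 * x * z^3 - 12 * y * z^3 - z^4)) q"
  proof (cases "q = 0")
    case True
    \<comment> \<open>With these values all four right-hand sides vanish, as \<open>q d/dq\<close>
      must at q = 0; only differentiability remains to be shown.\<close>
    have v: "x = 0" "y = 0" "z = 1" "P = 1"
      using True P7_eq[of 0] lam_id_eq_lam2[of 0] by (simp_all add: xyz x7_eq y7_eq z7_eq thetaq_0 eisP_def)
    have t: "\<exists>d. has_qderiv (thetaq a b) d 0" if "1 \<le> a" "a \<le> 6" "1 \<le> b" "b \<le> 6" for a b
      using has_qderiv_thetaq[OF _ that, of 0] by auto
    obtain d2 d1 d3 where d: "has_qderiv (thetaq 2 3) d2 0" "has_qderiv (thetaq 1 2) d1 0" "has_qderiv (thetaq 3 1) d3 0"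
      using t[of 2 3] t[of 1 2] t[of 3 1] by auto
    have "has_qderiv x7 0 0"
      unfolding x7_eq[abs_def] by (rule has_qderiv_at_0[OF has_qderiv_mult[OF has_qderiv_ident d(1)]])
    moreover have "has_qderiv y7 0 0"
      using has_qderiv_at_0[OF has_qderiv_cmult[OF has_qderiv_mult[OF has_qderiv_ident d(2)], of "-1"]]
      by (simp add: y7_eq[abs_def])
    moreover have "has_qderiv z7 0 0"
      using has_qderiv_at_0[OF d(3)] by (simp add: z7_eq[abs_def])
    moreover have "has_qderiv P7 0 0"
      using has_qderiv_P7[of 0] has_qderiv_at_0 by auto
    ultimately show ?thesis using True by (simp add: v)
  next
    case False
    \<comment> \<open>Folding with \<open>xyz7_eq\<close> replaces the zeta combinations by the
      theta quotients, which turns the system into the claimed one.\<close>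
    note s = level_7_system[OF False assms, folded xyz7_eq[OF False assms], folded xyz]
    note d = has_qderiv_xyz7[OF False assms, folded xyz]
    show ?thesis
      using d s(7) unfolding s(1-3) by simp
  qed
  then show ?thesis
    unfolding Let_def xyz by (elim conjE) (intro conjI has_qderiv_imp_deriv; assumption)
qed

end
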